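(* Let $(A,B)$ be a pair of invertible complex $3\times 3$ matrices in general position, i.e. belonging to a suitable nonempty Zariski-open, conjugation-invariant subset of $\mathrm{GL}(3,\mathbb{C})\times\mathrm{GL}(3,\mathbb{C})$. Let $(h_1,h_2,h_3)$ be any ordering of the eigenvalues of $A$ and $(\xi_1,\xi_2,\xi_3)$ any ordering of the eigenvalues of $B$. Let $\mathfrak{C}$ be the spectral curve of $(A,B)$, and let $Q=(L:M:1)$ be the distinguished point of $(A,B)$ with respect to the ordering $(h_1,h_2,h_3)$. Put $P_1=(h_1:-1:0)\in\mathfrak{C}$ and $X_1=(\xi_1:0:-1)\in\mathfrak{C}$. Let $T$ be the third point of intersection of the line $X_1Q$ with $\mathfrak{C}$, and let $Y$ be the third point of intersection of the line $P_1T$ with $\mathfrak{C}$. Then the transformation $(A,B)\mapsto(B,A)$, which corresponds to the matrix $\begin{pmatrix}0&1\\1&0\end{pmatrix}\in\mathrm{GL}(2,\mathbb{Z})$, acts on spectral data as follows: (i) the equation of the spectral curve of $(B,A)$ is obtained from the equation of the spectral curve of $(A,B)$ by transposing $\mu$ and $\nu$; (ii) the distinguished point of $(B,A)$, with respect to the ordering $(\xi_1,\xi_2,\xi_3)$ of the eigenvalues of $B$, is the image of $Y$ under the transposition $(\lambda:\mu:\nu)\mapsto(\lambda:\nu:\mu)$.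
   Context: The spectral curve of a pair $(A,B)$ is the plane cubic $\mathfrak{C}=\{(\lambda:\mu:\nu)\in\mathbb{CP}^2:\det(\lambda+\mu A+\nu B)=0\}$, with equation $\det(\lambda+\mu A+\nu B)=0$. For pairs in general position the curve is smooth. "Third point of intersection" of a line with the cubic is understood with multiplicity. Distinguished point. Let the first matrix $A$ of the pair have distinct eigenvalues, listed in a fixed order $h_1,h_2,h_3$. In a basis of eigenvectors of $A$ (in this order) we have $A=\mathrm{diag}(h_1,h_2,h_3)$, and $B$ has a matrix $U=(u_{ij})$, defined up to conjugation by a diagonal matrix. Assume $u_{12}u_{13}\neq0$. Put $$L=\frac{u_{12}h_3(u_{12}u_{23}-u_{13}u_{22})+u_{13}h_2(u_{12}u_{33}-u_{13}u_{32})}{u_{12}u_{13}(h_3-h_2)},$$ $$M=-\frac{u_{12}(u_{12}u_{23}-u_{13}u_{22})+u_{13}(u_{12}u_{33}-u_{13}u_{32})}{u_{12}u_{13}(h_3-h_2)}.$$ The distinguished point of $(A,B)$ with respect to this ordering is $(L:M:1)$. It is the unique point with $\nu=1$ for which $\ker(\lambda+\mu A+\nu B)$ contains a nonzero vector whose first coordinate in the eigenbasis of $A$ is $0$; it lies on $\mathfrak{C}$. The distinguished point of $(B,A)$ is defined by the same recipe with $B$ as the first matrix, with eigenvalues ordered as $\xi_1,\xi_2,\xi_3$, and $A$ as the second. The group $\mathrm{GL}(2,\mathbb{Z})\cong\mathrm{Out}(F_2)$ (outer automorphisms of the free group on $c_1,c_2$) acts on pairs of invertible matrices modulo simultaneous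 conjugation by substituting $A,B$ for $c_1,c_2$ in the images of the generators; the matrix $\begin{pmatrix}0&1\\1&0\end{pmatrix}$ is the class of $(c_1,c_2)\mapsto(c_2,c_1)$. *)

theory Defs
  imports
    "HOL-Analysis.Analysis"
    "HOL-Library.Multiset"
    "HOL-Computational_Algebra.Polynomial"
begin

section \<open>Pairs of matrices and general position\<close>

type_synonym mat3 = "complex^3^3"

definition GL3_pairs :: "(mat3 \<times> mat3) set" where
  "GL3_pairs = {(A, B). invertible A \<and> invertible B}"

definition sim_conj :: "mat3 \<times> mat3 \<Rightarrow> mat3 \<times> mat3 \<Rightarrow> bool" where
  "sim_conj p q \<longleftrightarrow> (\<exists>S. invertible S \<and>
     q = (S ** fst p ** matrix_inv S, S ** snd p ** matrix_inv S))"

inductive poly_fun :: "(mat3 \<times> mat3 \<Rightarrow> complex) \<Rightarrow> bool" where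
  const: "poly_fun (\<lambda>_. c)"
| fst_entry: "poly_fun (\<lambda>p. fst p $ i $ j)"
| snd_entry: "poly_fun (\<lambda>p. snd p $ i $ j)"
| add: "poly_fun f \<Longrightarrow> poly_fun g \<Longrightarrow> poly_fun (\<lambda>p. f p + g p)"
| mult: "poly_fun f \<Longrightarrow> poly_fun g \<Longrightarrow> poly_fun (\<lambda>p. f p * g p)"

text \<open>The topology induced from the affine space of all pairs. Allowing also inverse
  determinants in the equations would give the same open sets.\<close>

definition zariski_open :: "(mat3 \<times> mat3) set \<Rightarrow> bool" where
  "zariski_open G \<longleftrightarrow>
     (\<exists>F. (\<forall>f\<in>F. poly_fun f) \<and> G = {p \<in> GL3_pairs. \<exists>f\<in>F. f p \<noteq> 0})"

definition eigenvalues :: "mat3 \<Rightarrow> complex set" where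
  "eigenvalues A = {c. \<exists>v. v \<noteq> 0 \<and> A *v v = c *s v}"

text \<open>Only meaningful for matrices with three distinct eigenvalues; there is no ordering otherwise.\<close>

definition eigenvalue_ordering :: "mat3 \<Rightarrow> (3 \<Rightarrow> complex) \<Rightarrow> bool" where
  "eigenvalue_ordering A h \<longleftrightarrow> bij_betw h UNIV (eigenvalues A)"


section \<open>The projective plane and the spectral curve\<close>

text \<open>The point \<open>(\<lambda>:\<mu>:\<nu>)\<close> is the set of all its homogeneous coordinate vectors, so that equality
  of points is equality of sets.\<close>

definition pt :: "complex^3 \<Rightarrow> (complex^3) set" where
  "pt v = {c *s v | c. c \<noteq> 0}"

text \<open>The transposition \<open>(\<lambda>:\<mu>:\<nu>) \<mapsto> (\<lambda>:\<nu>:\<mu>)\<close> on coordinate vectors; on points it is the image map.\<close>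

definition swap23 :: "complex^3 \<Rightarrow> complex^3" where
  "swap23 v = vector [v$1, v$3, v$2]"

definition spectral_form :: "mat3 \<Rightarrow> mat3 \<Rightarrow> complex^3 \<Rightarrow> complex" where
  "spectral_form A B v = det (mat (v$1) + mat (v$2) ** A + mat (v$3) ** B)"

definition curve :: "(complex^3 \<Rightarrow> complex) \<Rightarrow> (complex^3) set set" where
  "curve F = {pt v | v. v \<noteq> 0 \<and> F v = 0}"

definition line_through :: "(complex^3) set \<Rightarrow> (complex^3) set \<Rightarrow> (complex^3) set set" where
  "line_through P Q = {pt (a *s p + b *s q) | a b p q.
     P = pt p \<and> Q = pt q \<and> a *s p + b *s q \<noteq> 0}"

text \<open>The curve \<open>F = 0\<close> and the line \<open>l\<close> (not a component of the curve) meet at the point \<open>X\<close> of \<open>l\<close>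
  with multiplicity \<open>k\<close>: with \<open>x + t y\<close> a parametrization of \<open>l\<close> near \<open>X = pt x\<close>, the polynomial
  \<open>F (x + t y)\<close> in \<open>t\<close> vanishes to order exactly \<open>k\<close> at \<open>t = 0\<close>.\<close>

definition int_mult ::
  "(complex^3 \<Rightarrow> complex) \<Rightarrow> (complex^3) set set \<Rightarrow> (complex^3) set \<Rightarrow> nat \<Rightarrow> bool" where
  "int_mult F l X k \<longleftrightarrow> (\<exists>x y r. x \<noteq> 0 \<and> y \<noteq> 0 \<and> X = pt x \<and> pt x \<in> l \<and> pt y \<in> l \<and> pt y \<noteq> pt x \<and>
     r \<noteq> 0 \<and> (\<forall>t. poly r t = F (x + t *s y)) \<and> order 0 r = k)"

text \<open>The line through the distinct points \<open>P\<close> and \<open>Q\<close> cuts out the divisor \<open>P + Q + R\<close> on the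
  cubic \<open>F = 0\<close>.\<close>

definition third_point ::
  "(complex^3 \<Rightarrow> complex) \<Rightarrow> (complex^3) set \<Rightarrow> (complex^3) set \<Rightarrow> (complex^3) set \<Rightarrow> bool" where
  "third_point F P Q R \<longleftrightarrow> P \<noteq> Q \<and> P \<in> curve F \<and> Q \<in> curve F \<and> R \<in> line_through P Q \<and>
     (\<forall>X \<in> line_through P Q. int_mult F (line_through P Q) X (count {#P, Q, R#} X))"


section \<open>The distinguished point\<close>

text \<open>The columns of \<open>S\<close> are eigenvectors of \<open>A\<close> for \<open>h 1, h 2, h 3\<close>.\<close>

definition eigenbasis :: "mat3 \<Rightarrow> (3 \<Rightarrow> complex) \<Rightarrow> mat3 \<Rightarrow> bool" where
  "eigenbasis A h S \<longleftrightarrow> invertible S \<and>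
     matrix_inv S ** A ** S = (\<chi> i j. if i = j then h i else 0)"

definition dist_L :: "(3 \<Rightarrow> complex) \<Rightarrow> mat3 \<Rightarrow> complex" where
  "dist_L h U =
     (U$1$2 * h 3 * (U$1$2 * U$2$3 - U$1$3 * U$2$2) + U$1$3 * h 2 * (U$1$2 * U$3$3 - U$1$3 * U$3$2))
       / (U$1$2 * U$1$3 * (h 3 - h 2))"

definition dist_M :: "(3 \<Rightarrow> complex) \<Rightarrow> mat3 \<Rightarrow> complex" where
  "dist_M h U =
     - (U$1$2 * (U$1$2 * U$2$3 - U$1$3 * U$2$2) + U$1$3 * (U$1$2 * U$3$3 - U$1$3 * U$3$2))
       / (U$1$2 * U$1$3 * (h 3 - h 2))"

definition distinguished_point ::
  "mat3 \<Rightarrow> mat3 \<Rightarrow> (3 \<Rightarrow> complex) \<Rightarrow> (complex^3) set \<Rightarrow> bool" where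
  "distinguished_point A B h Q \<longleftrightarrow> eigenvalue_ordering A h \<and>
     (\<exists>S U. eigenbasis A h S \<and> U = matrix_inv S ** B ** S \<and> U$1$2 * U$1$3 \<noteq> 0 \<and>
        Q = pt (vector [dist_L h U, dist_M h U, 1]))"


section \<open>Action of \<open>GL(2,\<int>)\<close> through automorphisms of the free group\<close>

datatype gen = C1 | C2

text \<open>Elements of the free group on \<open>C1, C2\<close> are words up to \<open>free_eq\<close>; the letter \<open>(c, True)\<close>
  stands for \<open>c\<close> and \<open>(c, False)\<close> for its inverse.\<close>

type_synonym word = "(gen \<times> bool) list"

inductive cancel1 :: "word \<Rightarrow> word \<Rightarrow> bool" where
  "cancel1 (u @ [(c, e), (c, \<not> e)] @ v) (u @ v)"

definition free_eq :: "word \<Rightarrow> word \<Rightarrow> bool" where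
  "free_eq = equivclp cancel1"

definition word_inv :: "word \<Rightarrow> word" where
  "word_inv w = rev (map (\<lambda>(c, e). (c, \<not> e)) w)"

definition word_subst :: "(gen \<Rightarrow> word) \<Rightarrow> word \<Rightarrow> word" where
  "word_subst \<phi> w = concat (map (\<lambda>(c, e). if e then \<phi> c else word_inv (\<phi> c)) w)"

definition free_aut :: "(gen \<Rightarrow> word) \<Rightarrow> bool" where
  "free_aut \<phi> \<longleftrightarrow> (\<exists>\<psi>. \<forall>c. free_eq (word_subst \<phi> (\<psi> c)) [(c, True)] \<and>
                             free_eq (word_subst \<psi> (\<phi> c)) [(c, True)])"

definition exp_sum :: "gen \<Rightarrow> word \<Rightarrow> int" where
  "exp_sum c w = (\<Sum>(d, e)\<leftarrow>w. if d = c then (if e then 1 else - 1) else 0)"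

text \<open>The matrix of the induced automorphism of \<open>\<int>\<^sup>2\<close>, which identifies \<open>Out(F\<^sub>2)\<close> with \<open>GL(2,\<int>)\<close>.\<close>

definition ab_matrix :: "(gen \<Rightarrow> word) \<Rightarrow> int^2^2" where
  "ab_matrix \<phi> = vector [vector [exp_sum C1 (\<phi> C1), exp_sum C1 (\<phi> C2)],
                         vector [exp_sum C2 (\<phi> C1), exp_sum C2 (\<phi> C2)]]"

fun word_eval :: "mat3 \<times> mat3 \<Rightarrow> word \<Rightarrow> mat3" where
  "word_eval p [] = mat 1"
| "word_eval p ((c, e) # w) =
     (let X = (case c of C1 \<Rightarrow> fst p | C2 \<Rightarrow> snd p)
      in (if e then X else matrix_inv X) ** word_eval p w)"

text \<open>\<open>g\<close> sends the simultaneous conjugacy class of \<open>p\<close> to that of \<open>q\<close>.\<close>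

definition GL2Z_acts :: "int^2^2 \<Rightarrow> mat3 \<times> mat3 \<Rightarrow> mat3 \<times> mat3 \<Rightarrow> bool" where
  "GL2Z_acts g p q \<longleftrightarrow> (\<exists>\<phi>. free_aut \<phi> \<and> ab_matrix \<phi> = g \<and>
     sim_conj (word_eval p (\<phi> C1), word_eval p (\<phi> C2)) q)"

end

theory Submission
  imports Defs "HOL-Computational_Algebra.Fundamental_Theorem_Algebra"
begin

text \<open>
  Let \<open>\<phi>\<close> and \<open>\<psi>\<close> be left eigenvectors, \<open>\<phi> A = h\<^sub>1 \<phi>\<close> and \<open>\<psi> B = \<xi>\<^sub>1 \<psi>\<close>. The distinguished point \<open>Q\<close> is the
  point of the pencil whose kernel contains the common zero \<open>v\<close> of \<open>\<phi>\<close> and \<open>\<phi> B\<close>. The four rows \<open>\<phi>\<close>, \<open>\<psi>\<close>,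
  \<open>\<phi> B\<close>, \<open>\<psi> A\<close> satisfy a linear relation, and this relation produces a point \<open>T\<close> of the curve whose left
  kernel vector lies in the span of \<open>\<phi>\<close> and \<open>\<psi>\<close>. Evaluating the relation and \<open>\<psi> (L + M A + B) = 0\<close> on \<open>v\<close>
  shows that \<open>X\<^sub>1\<close>, \<open>Q\<close>, \<open>T\<close> are collinear. As \<open>T\<close> is symmetric in \<open>(A, \<phi>)\<close> and \<open>(B, \<psi>)\<close>, it is also collinear
  with \<open>P\<^sub>1\<close> and the transposed distinguished point of \<open>(B, A)\<close>.

  All this needs only the nonvanishing of a polynomial in \<open>A\<close>, \<open>B\<close>, \<open>h\<^sub>1\<close>, \<open>\<xi>\<^sub>1\<close>. Substituting \<open>B\<close> for \<open>\<xi>\<^sub>1\<close> and \<open>A\<close>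
  for \<open>h\<^sub>1\<close> and taking determinants eliminates the eigenvalues, which gives a polynomial condition on the pair,
  and an explicit pair satisfies it.
\<close>

section \<open>Vectors and the matrix pencil\<close>

text \<open>Complex bilinear, without conjugation, so that it is the pairing of a row with a
  column.\<close>

definition bil :: "complex^3 \<Rightarrow> complex^3 \<Rightarrow> complex" where
  "bil x y = x$1 * y$1 + x$2 * y$2 + x$3 * y$3"

definition cross :: "complex^3 \<Rightarrow> complex^3 \<Rightarrow> complex^3" where
  "cross x y = vector [x$2 * y$3 - x$3 * y$2, x$3 * y$1 - x$1 * y$3, x$1 * y$2 - x$2 * y$1]"

lemma cross_nth [simp]:
  "cross x y $ 1 = x$2 * y$3 - x$3 * y$2"
  "cross x y $ 2 = x$3 * y$1 - x$1 * y$3"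
  "cross x y $ 3 = x$1 * y$2 - x$2 * y$1"
  by (simp_all add: cross_def vector_3)

lemma bil_cross_self [simp]: "bil x (cross x y) = 0" "bil y (cross x y) = 0"
  by (simp_all add: bil_def algebra_simps)

lemma bil_vmult: "bil (x v* A) y = bil x (A *v y)"
  by (simp add: bil_def vector_matrix_mult_def matrix_vector_mult_def sum_3 algebra_simps)

lemma bil_add_right: "bil x (y + z) = bil x y + bil x z"
  and bil_scale_left: "bil (c *s x) y = c * bil x y"
  and bil_scale_right: "bil x (c *s y) = c * bil x y"
  and bil_zero_right [simp]: "bil x 0 = 0"
  by (simp_all add: bil_def algebra_simps)

lemma cross_zero [simp]: "cross 0 y = 0" "cross x 0 = 0"
  by (simp_all add: vec_eq_iff forall_3)

lemma cross_eigenvector_zero: "A *v x = c *s x \<Longrightarrow> cross x (A *v x) = 0"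
  by (simp add: vec_eq_iff forall_3 algebra_simps)

text \<open>Cramer's rule for four vectors in three-space: up to sign, each coefficient is the
  determinant of the other three vectors.\<close>

lemma four_vector_relation:
  "- bil f (cross y g) *s x - bil g (cross x f) *s y + bil x (cross y g) *s f + bil y (cross x f) *s g = 0"
  by (simp add: vec_eq_iff forall_3 bil_def algebra_simps)

text \<open>The three vectors lie in the plane orthogonal to \<open>p\<close>. The minor
  \<open>d\<close> being nonzero, Cramer's rule in the last two coordinates gives the
  coefficients.\<close>

lemma orthogonal_vectors_dependent:
  assumes "p \<noteq> 0" "bil p x = 0" "bil p y = 0" "bil p z = 0" and d: "cross x y $ 1 \<noteq> 0"
  shows "(cross y z $ 1 / cross x y $ 1) *s x - (cross x z $ 1 / cross x y $ 1) *s y + z = 0"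
proof -
  let ?d = "cross x y $ 1"
  have p1: "p$1 \<noteq> 0"
  proof
    assume "p$1 = 0"
    hence e: "p$2 * x$2 + p$3 * x$3 = 0" "p$2 * y$2 + p$3 * y$3 = 0"
      using assms by (simp_all add: bil_def)
    have "p$2 * ?d = (p$2 * x$2 + p$3 * x$3) * y$3 - (p$2 * y$2 + p$3 * y$3) * x$3"
      "p$3 * ?d = (p$2 * y$2 + p$3 * y$3) * x$2 - (p$2 * x$2 + p$3 * x$3) * y$2"
      by (simp_all add: algebra_simps)
    with e d have "p$2 = 0" "p$3 = 0" by auto
    with \<open>p$1 = 0\<close> \<open>p \<noteq> 0\<close> show False by (simp add: vec_eq_iff forall_3)
  qed
  let ?w = "(cross y z $ 1) *s x - (cross x z $ 1) *s y + ?d *s z"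
  \<comment> \<open>These two coordinates vanish identically; orthogonality to \<open>p\<close> with
    \<open>p$1 \<noteq> 0\<close> then settles the first.\<close>
  have w23: "?w $ 2 = 0" "?w $ 3 = 0" by (simp_all add: algebra_simps)
  have "bil p ?w = (cross y z $ 1) * bil p x - (cross x z $ 1) * bil p y + ?d * bil p z"
    by (simp add: bil_def algebra_simps)
  hence "bil p ?w = 0" using assms by simp
  hence "p$1 * ?w$1 = 0" using w23 by (simp add: bil_def)
  with p1 have "?w $ 1 = 0" by simp
  with w23 have "?w = 0" by (simp only: vec_eq_iff forall_3 zero_index)
  hence "(1 / ?d) *s ?w = 0" by simp
  moreover have "(1 / ?d) *s ?w = (cross y z $ 1 / ?d) *s x - (cross x z $ 1 / ?d) *s y + z"
    using d by (simp add: vec_eq_iff divide_simps del: cross_nth)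
  ultimately show ?thesis by simp
qed

definition pencil :: "mat3 \<Rightarrow> mat3 \<Rightarrow> complex^3 \<Rightarrow> mat3" where
  "pencil A B v = mat (v$1) + mat (v$2) ** A + mat (v$3) ** B"

lemma pencil_nth:
  "pencil A B v $ i $ j = (if i = j then v$1 else 0) + v$2 * A$i$j + v$3 * B$i$j"
proof -
  have "(\<Sum>k\<in>UNIV. (if i = k then c else 0) * (M :: mat3) $ k $ j) = c * M $ i $ j" for c M
  proof -
    have "(\<Sum>k\<in>UNIV. (if i = k then c else 0) * M $ k $ j) = (\<Sum>k\<in>UNIV. if i = k then c * M $ k $ j else 0)"
      by (rule sum.cong) auto
    thus ?thesis by simp
  qed
  thus ?thesis by (simp add: pencil_def mat_def matrix_matrix_mult_def)
qed

lemma pencil_mult: "pencil A B v *v x = v$1 *s x + v$2 *s (A *v x) + v$3 *s (B *v x)"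
  by (simp add: vec_eq_iff forall_3 matrix_vector_mult_def sum_3 pencil_nth algebra_simps)

lemma mult_pencil: "x v* pencil A B v = v$1 *s x + v$2 *s (x v* A) + v$3 *s (x v* B)"
  by (simp add: vec_eq_iff forall_3 vector_matrix_mult_def sum_3 pencil_nth algebra_simps)

lemma spectral_form_pencil: "spectral_form A B v = det (pencil A B v)"
  by (simp add: spectral_form_def pencil_def)

lemma det_zero_iff_kernel: "det (M :: mat3) = 0 \<longleftrightarrow> (\<exists>x. x \<noteq> 0 \<and> M *v x = 0)"
  using invertible_det_nz[of M] matrix_left_invertible_ker[of M] invertible_left_inverse[of M] by auto

lemma det_zero_if_left_kernel: "x \<noteq> 0 \<Longrightarrow> x v* M = 0 \<Longrightarrow> det (M :: mat3) = 0"
  using det_zero_iff_kernel[of "transpose M"] by (metis det_transpose transpose_matrix_vector)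

lemma eigenvalues_det: "eigenvalues A = {c. det (mat c - A) = 0}"
proof -
  have "(mat c - A) *v x = c *s x - A *v x" for c x
    by (simp add: matrix_vector_mult_diff_rdistrib vec_eq_iff forall_3 matrix_vector_mult_def sum_3 mat_def algebra_simps)
  thus ?thesis by (auto simp: eigenvalues_def det_zero_iff_kernel)
qed

lemma spectral_form_scale: "spectral_form A B (c *s v) = c ^ 3 * spectral_form A B v"
  by (simp add: spectral_form_pencil det_3 pencil_nth power3_eq_cube algebra_simps)


text \<open>Multilinearity in the rows: the mixed coefficients sum the determinants with one row
  taken from the other matrix.\<close>

lemma binary_cubic:
  "\<exists>c0 c1 c2 c3. \<forall>a b. det (\<chi> i j. a * X$i$j + b * (Y::mat3)$i$j)
     = c0 * a^3 + c1 * a^2 * b + c2 * a * b^2 + c3 * b^3"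
proof -
  let ?D = "\<lambda>U V k. det (\<chi> i j. if i = k then V$i$j else U$i$j)"
  show ?thesis
    by (intro exI[of _ "det X"] exI[of _ "?D X Y 1 + ?D X Y 2 + ?D X Y 3"]
          exI[of _ "?D Y X 1 + ?D Y X 2 + ?D Y X 3"] exI[of _ "det Y"])
       (simp add: det_3 power3_eq_cube power2_eq_square algebra_simps)
qed

lemma spectral_form_binary_cubic:
  "\<exists>c0 c1 c2 c3. \<forall>a b. spectral_form A B (a *s p + b *s q)
     = c0 * a^3 + c1 * a^2 * b + c2 * a * b^2 + c3 * b^3"
proof -
  have "pencil A B (a *s p + b *s q) = (\<chi> i j. a * pencil A B p$i$j + b * pencil A B q$i$j)" for a b
    by (simp add: vec_eq_iff pencil_nth algebra_simps)
  thus ?thesis using binary_cubic[of "pencil A B p" "pencil A B q"] by (simp add: spectral_form_pencil)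
qed

section \<open>The collinear points\<close>

text \<open>The common zero \<open>v\<close> of the rows \<open>\<phi>\<close> and
  \<open>\<phi> v* B\<close>, determined up to scale when these are independent.\<close>

definition normal :: "complex^3 \<Rightarrow> mat3 \<Rightarrow> complex^3" where
  "normal \<phi> B = cross \<phi> (\<phi> v* B)"

text \<open>In the relation of lemma \<open>four_vector_relation\<close> between \<open>\<phi>\<close>, \<open>\<psi>\<close>, \<open>\<phi> B\<close>, \<open>\<psi> A\<close>, the coefficients
  of \<open>\<psi> A\<close> and of \<open>\<psi>\<close> are \<open>image_coeff \<phi> \<psi> B\<close> and \<open>row_coeff \<phi> \<psi> A B\<close>; those of \<open>\<phi> B\<close> and \<open>\<phi>\<close>
  arise by exchanging the roles of \<open>(\<phi>, A)\<close> and \<open>(\<psi>, B)\<close>. The left kernel vector at \<open>T\<close> is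
  \<open>weight \<psi> \<phi> B A \<xi> *s \<phi> + weight \<phi> \<psi> A B h *s \<psi>\<close>.\<close>

definition image_coeff :: "complex^3 \<Rightarrow> complex^3 \<Rightarrow> mat3 \<Rightarrow> complex" where
  "image_coeff \<phi> \<psi> B = bil \<psi> (normal \<phi> B)"

definition row_coeff :: "complex^3 \<Rightarrow> complex^3 \<Rightarrow> mat3 \<Rightarrow> mat3 \<Rightarrow> complex" where
  "row_coeff \<phi> \<psi> A B = - bil (\<psi> v* A) (normal \<phi> B)"

definition weight :: "complex^3 \<Rightarrow> complex^3 \<Rightarrow> mat3 \<Rightarrow> mat3 \<Rightarrow> complex \<Rightarrow> complex" where
  "weight \<phi> \<psi> A B h = row_coeff \<phi> \<psi> A B + h * image_coeff \<phi> \<psi> B"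

text \<open>Found by matching coefficients: the row \<open>a *s \<phi> + b *s \<psi>\<close> times
  the pencil at this point is to be \<open>a * b\<close> times the four-row relation. The rows
  \<open>\<psi> v* A\<close> and \<open>\<phi> v* B\<close> fix the last two coordinates. The rows
  \<open>\<phi>\<close> and \<open>\<psi>\<close> each give a condition on the first, and the
  weights \<open>a\<close>, \<open>b\<close> are what makes the two agree.\<close>

definition T_vec :: "complex^3 \<Rightarrow> complex^3 \<Rightarrow> mat3 \<Rightarrow> mat3 \<Rightarrow> complex \<Rightarrow> complex \<Rightarrow> complex^3" where
  "T_vec \<phi> \<psi> A B h \<xi> =
     (let a = weight \<psi> \<phi> B A \<xi>; b = weight \<phi> \<psi> A B h
      in vector [a * b - a * image_coeff \<phi> \<psi> B * h - b * image_coeff \<psi> \<phi> A * \<xi>,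
                  a * image_coeff \<phi> \<psi> B, b * image_coeff \<psi> \<phi> A])"

text \<open>The coefficients of the relation between \<open>v\<close>, \<open>A *v v\<close>,
  \<open>B *v v\<close> from \<open>orthogonal_vectors_dependent\<close>, scaled to
  \<open>\<nu> = 1\<close>.\<close>

definition Q_vec :: "mat3 \<Rightarrow> mat3 \<Rightarrow> complex^3 \<Rightarrow> complex^3" where
  "Q_vec A B v =
     vector [cross (A *v v) (B *v v) $ 1 / cross v (A *v v) $ 1,
             - (cross v (B *v v) $ 1 / cross v (A *v v) $ 1), 1]"

text \<open>The value of the spectral form occurring here keeps the line through \<open>X\<^sub>1\<close> and \<open>Q\<close> from being a
  component of the curve; the last factor keeps \<open>T\<close> away from \<open>Q\<close>, and the other factors keep
  \<open>X\<^sub>1\<close>, \<open>Q\<close>, \<open>T\<close> well defined and \<open>X\<^sub>1\<close> different from both.\<close>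

definition obstruction ::
  "complex^3 \<Rightarrow> complex^3 \<Rightarrow> mat3 \<Rightarrow> mat3 \<Rightarrow> complex \<Rightarrow> complex \<Rightarrow> complex" where
  "obstruction \<phi> \<psi> A B h \<xi> =
     (let a = weight \<psi> \<phi> B A \<xi>; b = weight \<phi> \<psi> A B h; v = normal \<phi> B;
          vA = cross v (A *v v) $ 1; vB = cross v (B *v v) $ 1
      in a * image_coeff \<psi> \<phi> A * image_coeff \<phi> \<psi> B * spectral_form A B (vector [row_coeff \<phi> \<psi> A B, image_coeff \<phi> \<psi> B, 0])
         * vA * vB * (a * image_coeff \<phi> \<psi> B * vA + b * image_coeff \<psi> \<phi> A * vB))"

text \<open>An algebraic form, in coordinate vectors, of a line meeting the cubic in three distinct
  points. The last clause keeps the line from being a component and, for a homogeneous form, makes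
  \<open>p\<close> and \<open>q\<close> independent; the nonzero coefficients then make the three
  points distinct.\<close>

definition secant_triple :: "(complex^3 \<Rightarrow> complex) \<Rightarrow> complex^3 \<Rightarrow> complex^3 \<Rightarrow> complex^3 \<Rightarrow> bool" where
  "secant_triple F p q r \<longleftrightarrow> F p = 0 \<and> F q = 0 \<and> F r = 0 \<and>
     (\<exists>a b c. a \<noteq> 0 \<and> b \<noteq> 0 \<and> c \<noteq> 0 \<and> a *s p + b *s q + c *s r = 0) \<and>
     (\<exists>a b. F (a *s p + b *s q) \<noteq> 0)"

lemma normal_orthogonal:
  assumes "\<phi> v* A = h *s \<phi>"
  shows "bil \<phi> (normal \<phi> B) = 0" "bil \<phi> (A *v normal \<phi> B) = 0" "bil \<phi> (B *v normal \<phi> B) = 0"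
  using assms by (simp_all add: normal_def bil_scale_left flip: bil_vmult)

lemma Q_vec_kernel:
  assumes "\<phi> v* A = h *s \<phi>" and d: "cross (normal \<phi> B) (A *v normal \<phi> B) $ 1 \<noteq> 0"
  shows "pencil A B (Q_vec A B (normal \<phi> B)) *v normal \<phi> B = 0"
proof -
  have "\<phi> \<noteq> 0" using d by (auto simp: normal_def)
  from orthogonal_vectors_dependent[OF this normal_orthogonal[OF assms(1)] d]
  show ?thesis by (simp add: pencil_mult Q_vec_def vector_3 vec_eq_iff)
qed

lemma vmult_combination:
  "(a *s x + b *s y) v* (M :: mat3) = a *s (x v* M) + b *s (y v* M)"
  by (simp add: vec_eq_iff forall_3 vector_matrix_mult_def sum_3 algebra_simps)

lemma distinguished_secant_triple:
  assumes \<phi>: "\<phi> v* A = h *s \<phi>" and \<psi>: "\<psi> v* B = \<xi> *s \<psi>"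
    and gen: "obstruction \<phi> \<psi> A B h \<xi> \<noteq> 0"
  shows "secant_triple (spectral_form A B) (vector [\<xi>, 0, -1]) (Q_vec A B (normal \<phi> B)) (T_vec \<phi> \<psi> A B h \<xi>)"
proof -
  define v where "v = normal \<phi> B"
  define w where "w = normal \<psi> A"
  define k1 where "k1 = row_coeff \<psi> \<phi> B A"
  define k2 where "k2 = row_coeff \<phi> \<psi> A B"
  define k3 where "k3 = image_coeff \<psi> \<phi> A"
  define k4 where "k4 = image_coeff \<phi> \<psi> B"
  define a where "a = k1 + \<xi> * k3"
  define b where "b = k2 + h * k4"
  define vA where "vA = cross v (A *v v) $ 1"
  define vB where "vB = cross v (B *v v) $ 1"
  define q where "q = Q_vec A B v"
  define x where "x = (vector [\<xi>, 0, -1] :: complex^3)"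
  define t where "t = T_vec \<phi> \<psi> A B h \<xi>"
  note defs = k1_def k2_def k3_def k4_def a_def b_def vA_def vB_def v_def w_def
  have nz: "a \<noteq> 0" "k3 \<noteq> 0" "k4 \<noteq> 0" "vA \<noteq> 0" "vB \<noteq> 0" "a * k4 * vA + b * k3 * vB \<noteq> 0"
      and nzF: "spectral_form A B (vector [k2, k4, 0]) \<noteq> 0"
    using gen by (simp_all add: obstruction_def Let_def weight_def defs)
  have t: "t$1 = a * b - a * k4 * h - b * k3 * \<xi>" "t$2 = a * k4" "t$3 = b * k3"
    by (simp_all add: t_def T_vec_def Let_def weight_def defs vector_3)
  have x: "x$1 = \<xi>" "x$2 = 0" "x$3 = -1" by (simp_all add: x_def vector_3)
  define M where "M = - (vB / vA)"
  have q: "q$2 = M" "q$3 = 1" by (simp_all add: q_def Q_vec_def vector_3 M_def vA_def vB_def)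
  have M: "M \<noteq> 0" using nz by (simp add: M_def)
  have v0: "v \<noteq> 0" using nz(4) by (auto simp: vA_def)
  have \<psi>0: "\<psi> \<noteq> 0" using nz(2) by (auto simp: k3_def image_coeff_def normal_def)
  have ker: "pencil A B q *v v = 0"
    using Q_vec_kernel[OF \<phi>] nz(4) by (simp add: q_def v_def vA_def)
  have Fq: "spectral_form A B q = 0"
    using ker v0 by (auto simp: spectral_form_pencil det_zero_iff_kernel)
  have "\<psi> v* pencil A B x = 0" using \<psi> by (simp add: mult_pencil x)
  hence Fx: "spectral_form A B x = 0"
    using \<psi>0 by (auto simp: spectral_form_pencil det_zero_if_left_kernel)
  \<comment> \<open>Pairing the kernel equation at \<open>Q\<close> with \<open>\<psi>\<close>
    replaces \<open>B\<close> by \<open>\<xi>\<close>, which ties \<open>q$1 + \<xi>\<close> to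
    \<open>M\<close>.\<close>
  have "bil \<psi> (pencil A B q *v v) = (q$1 + \<xi>) * k4 - M * k2"
    by (simp add: pencil_mult bil_add_right bil_scale_right q \<psi> bil_scale_left defs image_coeff_def row_coeff_def
        algebra_simps flip: bil_vmult)
  hence L: "(q$1 + \<xi>) * k4 = M * k2" using ker by simp
  let ?\<chi> = "a *s \<phi> + b *s \<psi>"
  have rel: "k1 *s \<phi> + k2 *s \<psi> + k3 *s (\<phi> v* B) + k4 *s (\<psi> v* A) = 0"
    using four_vector_relation[of "\<phi> v* B" \<psi> "\<psi> v* A" \<phi>]
    by (simp add: defs row_coeff_def image_coeff_def normal_def)
  have "?\<chi> v* pencil A B t = (a * b) *s (k1 *s \<phi> + k2 *s \<psi> + k3 *s (\<phi> v* B) + k4 *s (\<psi> v* A))"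
    unfolding mult_pencil t vmult_combination \<phi> \<psi>
    by (simp add: vec_eq_iff a_def b_def algebra_simps)
  hence "?\<chi> v* pencil A B t = 0" by (simp add: rel)
  \<comment> \<open>The vector \<open>w\<close> is annihilated by \<open>\<psi>\<close> and isolates
    the coefficient of \<open>\<phi>\<close>.\<close>
  moreover have "?\<chi> \<noteq> 0"
  proof
    assume 0: "?\<chi> = 0"
    have "bil ?\<chi> w = a * k3"
      by (simp add: w_def k3_def image_coeff_def bil_def normal_def algebra_simps)
    with 0 nz show False by (simp add: bil_def)
  qed
  ultimately have Ft: "spectral_form A B t = 0"
    by (auto simp: spectral_form_pencil det_zero_if_left_kernel)
  define m where "m = M / k4"
  have m: "m \<noteq> 0" "M = m * k4" "q$1 + \<xi> = m * k2"
    using nz M L by (simp_all add: m_def field_simps)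
  \<comment> \<open>The line through \<open>X_1\<close> and \<open>Q\<close> meets
    \<open>\<nu> = 0\<close> here, and the obstruction demands that the spectral form be nonzero at
    this point.\<close>
  have "1 *s q + 1 *s x = m *s vector [k2, k4, 0]"
    using m by (simp add: vec_eq_iff forall_3 vector_3 x q)
  hence offcurve: "spectral_form A B (1 *s x + 1 *s q) \<noteq> 0"
    using nzF m by (simp add: spectral_form_scale add.commute)
  \<comment> \<open>If this coefficient of \<open>x\<close> vanished, \<open>T\<close> would
    coincide with \<open>Q\<close>; the last factor of the obstruction excludes that.\<close>
  have coef: "a / m - b * k3 \<noteq> 0"
  proof
    assume "a / m - b * k3 = 0"
    hence "a * k4 = b * k3 * M" using m nz by (simp add: field_simps)
    hence "a * k4 * vA = - (b * k3 * vB)" using nz by (simp add: M_def field_simps)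
    thus False using nz by simp
  qed
  \<comment> \<open>The coefficient of \<open>q\<close> is forced by the second coordinate of
    \<open>t\<close>, that of \<open>x\<close> by the third; the first coordinate is then an
    identity.\<close>
  have collinear: "(a / m - b * k3) *s x + (a / m) *s q + (-1) *s t = 0"
  proof -
    have "(a / m - b * k3) * \<xi> + a / m * q$1 = (a / m) * (q$1 + \<xi>) - b * k3 * \<xi>"
      by (simp add: algebra_simps)
    also have "\<dots> = t$1" using m by (simp add: t b_def algebra_simps)
    finally show ?thesis using m by (simp add: vec_eq_iff forall_3 x q t algebra_simps)
  qed
  have "secant_triple (spectral_form A B) x q t"
    unfolding secant_triple_def
  proof (intro conjI)
    show "\<exists>a b c. a \<noteq> 0 \<and> b \<noteq> 0 \<and> c \<noteq> 0 \<and> a *s x + b *s q + c *s t = 0"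
      using coef collinear nz(1) m(1)
      by (intro exI[of _ "a / m - b * k3"] exI[of _ "a / m"] exI[of _ "-1"]) simp
  qed (use Fx Fq Ft offcurve in blast)+
  thus ?thesis by (simp add: x_def q_def t_def v_def)
qed

section \<open>Third intersection points\<close>

lemma pt_self: "x \<in> pt x"
  by (auto simp: pt_def intro: exI[of _ 1])

lemma pt_scale: "c \<noteq> 0 \<Longrightarrow> pt (c *s x) = pt x"
proof (intro set_eqI iffI)
  fix y assume c: "c \<noteq> 0" and "y \<in> pt x"
  then obtain d where "d \<noteq> 0" "y = (d / c) *s (c *s x)" by (auto simp: pt_def)
  with c show "y \<in> pt (c *s x)" unfolding pt_def by (metis (mono_tags, lifting) divide_eq_0_iff mem_Collect_eq)
next
  fix y assume "c \<noteq> 0" and "y \<in> pt (c *s x)"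
  then obtain d where "d \<noteq> 0" "y = (d * c) *s x" by (auto simp: pt_def)
  with \<open>c \<noteq> 0\<close> show "y \<in> pt x" unfolding pt_def by (metis (mono_tags, lifting) mult_eq_0_iff mem_Collect_eq)
qed

lemma pt_eq_iff: "pt x = pt y \<longleftrightarrow> (\<exists>c. c \<noteq> 0 \<and> x = c *s y)"
  using pt_self[of x] pt_scale by (auto simp: pt_def[of y])

lemma line_through_pt:
  "line_through (pt p) (pt q) = {pt (a *s p + b *s q) | a b. a *s p + b *s q \<noteq> 0}" (is "_ = ?R")
proof
  show "line_through (pt p) (pt q) \<subseteq> ?R"
  proof
    fix X assume "X \<in> line_through (pt p) (pt q)"
    then obtain a b p' q' where *: "pt p = pt p'" "pt q = pt q'"
      "X = pt (a *s p' + b *s q')" "a *s p' + b *s q' \<noteq> 0"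
      by (auto simp: line_through_def)
    from *(1,2)[symmetric] obtain c d where "p' = c *s p" "q' = d *s q" by (auto simp: pt_eq_iff)
    hence "a *s p' + b *s q' = (a * c) *s p + (b * d) *s q" by simp
    with *(3,4) show "X \<in> ?R" by auto
  qed
qed (auto simp: line_through_def)

lemma curve_spectral_form_pt:
  assumes "x \<noteq> 0"
  shows "pt x \<in> curve (spectral_form A B) \<longleftrightarrow> spectral_form A B x = 0"
proof
  assume "pt x \<in> curve (spectral_form A B)"
  thus "spectral_form A B x = 0" by (auto simp: curve_def pt_eq_iff spectral_form_scale)
qed (use assms in \<open>auto simp: curve_def\<close>)

lemma order_0_pCons: "c \<noteq> 0 \<or> d \<noteq> 0 \<Longrightarrow> order 0 [:c, d:] = (if c = 0 then 1 else 0)"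
  for c d :: complex
  using order_0_monom[of d 1] by (auto simp: order_0I monom_altdef)

text \<open>If \<open>p\<close> and \<open>q\<close> were dependent, every combination would be a
  multiple of one of them, so the form would vanish on all of them.\<close>

lemma secant_triple_independent:
  assumes "secant_triple (spectral_form A B) p q r" "a *s p + b *s q = 0"
  shows "a = 0 \<and> b = 0"
proof -
  from assms obtain c d where Fp: "spectral_form A B p = 0" and Fq: "spectral_form A B q = 0"
    and cd: "spectral_form A B (c *s p + d *s q) \<noteq> 0" by (auto simp: secant_triple_def)
  have "a = 0"
  proof (rule ccontr)
    assume "a \<noteq> 0"
    hence "p$i = - (b / a) * q$i" for i
      using assms(2) by (simp add: vec_eq_iff field_simps eq_neg_iff_add_eq_0)
    hence "c *s p + d *s q = (d - c * b / a) *s q" by (simp add: vec_eq_iff algebra_simps)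
    with cd Fq show False by (metis spectral_form_scale mult_zero_right)
  qed
  moreover have "b = 0"
  proof (rule ccontr)
    assume "b \<noteq> 0"
    hence "q$i = - (a / b) * p$i" for i
      using assms(2) by (simp add: vec_eq_iff field_simps eq_neg_iff_add_eq_0)
    hence "c *s p + d *s q = (c - d * a / b) *s p" by (simp add: vec_eq_iff algebra_simps)
    with cd Fp show False by (metis spectral_form_scale mult_zero_right)
  qed
  ultimately show ?thesis by simp
qed

text \<open>As \<open>b\<close> is nonzero, \<open>q\<close> lies in the span of \<open>p\<close>
  and \<open>r\<close>, so both pairs span the same line.\<close>

lemma secant_triple_rotate:
  assumes "secant_triple F p q r" shows "secant_triple F p r q"
proof -
  from assms obtain a b c where abc: "a \<noteq> 0" "b \<noteq> 0" "c \<noteq> 0" "a *s p + b *s q + c *s r = 0"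
    by (auto simp: secant_triple_def)
  from assms obtain d e where de: "F (d *s p + e *s q) \<noteq> 0" by (auto simp: secant_triple_def)
  have "q$i = - (a / b) * p$i - (c / b) * r$i" for i
  proof -
    have "a * p$i + b * q$i + c * r$i = 0" using abc(4) by (simp add: vec_eq_iff)
    hence "b * q$i = - a * p$i - c * r$i" by algebra
    thus ?thesis using abc by (simp add: field_simps)
  qed
  hence q: "q = (- (a / b)) *s p + (- (c / b)) *s r"
    by (simp add: vec_eq_iff)
  have "d *s p + e *s q = (d - e * a / b) *s p + (- e * c / b) *s r"
    unfolding q by (simp add: vec_eq_iff algebra_simps)
  with de have "\<exists>a b. F (a *s p + b *s r) \<noteq> 0" by metis
  moreover have "a *s p + c *s r + b *s q = 0" using abc(4) by (simp add: algebra_simps)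
  ultimately show ?thesis using assms abc unfolding secant_triple_def by blast
qed

text \<open>On the line the form is a nonzero binary cubic with three distinct, hence simple, zeros
  at \<open>p\<close>, \<open>q\<close>, \<open>r\<close>, and this gives every intersection
  multiplicity. Conversely, a different third point would require multiplicity 0 at
  \<open>r\<close>, where the form vanishes.\<close>

lemma third_point_iff:
  assumes secant_triple: "secant_triple (spectral_form A B) p q r"
  shows "third_point (spectral_form A B) (pt p) (pt q) Z \<longleftrightarrow> Z = pt r"
proof -
  let ?F = "spectral_form A B" and ?l = "line_through (pt p) (pt q)"
  note ind = secant_triple_independent[OF secant_triple]
  from secant_triple obtain a b c where abc: "a \<noteq> 0" "b \<noteq> 0" "c \<noteq> 0" "a *s p + b *s q + c *s r = 0"
    by (auto simp: secant_triple_def)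
  hence "a *s p + b *s q = (- c) *s r"
    by (simp add: vec_eq_iff eq_neg_iff_add_eq_0)
  moreover have "?F ((- c) *s r) = 0"
    using secant_triple unfolding spectral_form_scale by (simp add: secant_triple_def)
  ultimately have R: "pt r = pt (a *s p + b *s q)" and FR: "?F (a *s p + b *s q) = 0"
    using abc pt_scale[of "-c" r] by simp_all
  have nz: "s *s p + t *s q \<noteq> 0" if "s \<noteq> 0 \<or> t \<noteq> 0" for s t using ind that by blast
  have pt_comb: "pt (s *s p + t *s q) = pt (s' *s p + t' *s q) \<longleftrightarrow> s * t' = t * s'"
    if "s \<noteq> 0 \<or> t \<noteq> 0" "s' \<noteq> 0 \<or> t' \<noteq> 0" for s t s' t'
  proof
    assume "pt (s *s p + t *s q) = pt (s' *s p + t' *s q)"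
    then obtain d where "s *s p + t *s q = d *s (s' *s p + t' *s q)" by (auto simp: pt_eq_iff)
    hence "(s - d * s') *s p + (t - d * t') *s q = 0" by (simp add: vec_eq_iff algebra_simps)
    from ind[OF this] show "s * t' = t * s'" by simp
  next
    assume e: "s * t' = t * s'"
    define d where "d = (if s' = 0 then t / t' else s / s')"
    have "s = d * s'" "t = d * t'" "d \<noteq> 0" using e that by (auto simp: d_def field_simps split: if_splits)
    hence "s *s p + t *s q = d *s (s' *s p + t' *s q)" by (simp add: vec_eq_iff algebra_simps)
    with \<open>d \<noteq> 0\<close> show "pt (s *s p + t *s q) = pt (s' *s p + t' *s q)" by (auto simp: pt_eq_iff)
  qed
  obtain c0 c1 c2 c3 where cubic:
    "\<And>s t. ?F (s *s p + t *s q) = c0 * s^3 + c1 * s^2 * t + c2 * s * t^2 + c3 * t^3"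
    using spectral_form_binary_cubic[of A B p q] by auto
  have "c0 = 0" "c3 = 0" using cubic[of 1 0] cubic[of 0 1] secant_triple by (simp_all add: secant_triple_def)
  have "a * b * (c1 * a + c2 * b) = 0"
    using cubic[of a b] FR \<open>c0 = 0\<close> \<open>c3 = 0\<close> by (simp add: power2_eq_square algebra_simps)
  with abc have c: "c1 * a + c2 * b = 0" by simp
  \<comment> \<open>Without its pure cubes the cubic is \<open>s * t\<close> times a linear form.
    That form vanishes at \<open>(a, b)\<close>, so it is
    \<open>k * (b * s - a * t)\<close>.\<close>
  define k where "k = c1 / b"
  have c12: "c1 = k * b" "c2 = - (k * a)"
    using abc(1-3) c by (simp_all add: k_def field_simps eq_neg_iff_add_eq_0)
  have F: "?F (s *s p + t *s q) = k * s * t * (b * s - a * t)" for s t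
    using \<open>c0 = 0\<close> \<open>c3 = 0\<close> by (simp add: cubic c12 power2_eq_square algebra_simps)
  have "k \<noteq> 0" using secant_triple by (auto simp: secant_triple_def F)
  have P: "pt p = pt (1 *s p + 0 *s q)" and Q: "pt q = pt (0 *s p + 1 *s q)" by simp_all
  have p0: "p \<noteq> 0" "q \<noteq> 0" using nz[of 1 0] nz[of 0 1] by simp_all
  have PQ: "pt p \<noteq> pt q" unfolding P Q by (subst pt_comb) auto
  have RP: "pt r \<noteq> pt p" "pt r \<noteq> pt q" unfolding P Q R using abc by (subst pt_comb; simp)+
  have onl: "pt (s *s p + t *s q) \<in> ?l" if "s \<noteq> 0 \<or> t \<noteq> 0" for s t
    using nz[OF that] by (auto simp: line_through_pt)
  have mult: "int_mult ?F ?l X (count {#pt p, pt q, pt r#} X)" if X: "X \<in> ?l" for X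
  proof -
    from X obtain s t where st: "X = pt (s *s p + t *s q)" "s *s p + t *s q \<noteq> 0"
      by (auto simp: line_through_pt)
    hence st0: "s \<noteq> 0 \<or> t \<noteq> 0" by auto
    \<comment> \<open>A second point of the line as direction of the parametrization:
      \<open>q\<close>, unless \<open>X\<close> is \<open>q\<close> itself, and then
      \<open>p\<close>.\<close>
    define s' t' :: complex where "s' = (if s \<noteq> 0 then 0 else 1)" and "t' = (if s \<noteq> 0 then 1 else 0)"
    have st': "s' \<noteq> 0 \<or> t' \<noteq> 0" and d: "s' * t \<noteq> t' * s" using st0 by (auto simp: s'_def t'_def)
    let ?p1 = "[:s, s':]" and ?p2 = "[:t, t':]" and ?p3 = "[:b * s - a * t, b * s' - a * t':]"
    define f where "f = smult k (?p1 * ?p2 * ?p3)"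
    have f: "poly f z = ?F ((s *s p + t *s q) + z *s (s' *s p + t' *s q))" for z
    proof -
      have *: "(s *s p + t *s q) + z *s (s' *s p + t' *s q) = (s + z * s') *s p + (t + z * t') *s q"
        by (simp add: vec_eq_iff algebra_simps)
      thus ?thesis unfolding * F f_def by (simp add: algebra_simps)
    qed
    have n1: "s \<noteq> 0 \<or> s' \<noteq> 0" and n2: "t \<noteq> 0 \<or> t' \<noteq> 0" using d by auto
    have n3: "b * s - a * t \<noteq> 0 \<or> b * s' - a * t' \<noteq> 0"
    proof (rule ccontr)
      assume "\<not> ?thesis"
      hence "b * s = a * t" "b * s' = a * t'" by simp_all
      hence "b * (s' * t) = b * (t' * s)" by (metis mult.left_commute mult.commute)
      with d abc show False by simp
    qed
    have f0: "f \<noteq> 0" using n1 n2 n3 \<open>k \<noteq> 0\<close> by (auto simp: f_def)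
    have "order 0 f = order 0 ?p1 + order 0 ?p2 + order 0 ?p3"
      using f0 \<open>k \<noteq> 0\<close> unfolding f_def by (subst order_smult, simp, subst order_mult, simp, subst order_mult) auto
    also have "\<dots> = (if s = 0 then 1 else 0) + (if t = 0 then 1 else 0) + (if b * s - a * t = 0 then 1 else 0)"
      using n1 n2 n3 by (simp only: order_0_pCons)
    also have "\<dots> = count {#pt p, pt q, pt r#} X"
    proof -
      have "pt p = X \<longleftrightarrow> t = 0" unfolding P st by (subst pt_comb) (use st0 in auto)
      moreover have "pt q = X \<longleftrightarrow> s = 0" unfolding Q st by (subst pt_comb) (use st0 in auto)
      moreover have "pt r = X \<longleftrightarrow> b * s - a * t = 0"
        unfolding R st by (subst pt_comb) (use st0 abc in auto)
      ultimately show ?thesis by simp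
    qed
    finally have ord: "order 0 f = count {#pt p, pt q, pt r#} X" .
    have "pt (s' *s p + t' *s q) \<noteq> X" unfolding st using d st0 st' by (subst pt_comb) auto
    thus ?thesis unfolding int_mult_def
      using st nz[OF st'] onl[OF st'] X f0 f ord by blast
  qed
  have "third_point ?F (pt p) (pt q) (pt r)"
    unfolding third_point_def using PQ mult p0 secant_triple onl[of a b] abc R
    by (auto simp: curve_spectral_form_pt secant_triple_def)
  moreover have "Z = pt r" if Z: "third_point ?F (pt p) (pt q) Z"
  proof (rule ccontr)
    assume "Z \<noteq> pt r"
    hence "count {#pt p, pt q, Z#} (pt r) = 0" using RP by auto
    moreover have "pt r \<in> ?l" using onl[of a b] abc R by simp
    ultimately have "int_mult ?F ?l (pt r) 0" using Z by (metis third_point_def)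
    then obtain x y f where xf: "pt r = pt x" "f \<noteq> 0" "order 0 f = 0"
      and "\<forall>z. poly f z = ?F (x + z *s y)" unfolding int_mult_def by blast
    from this(4)[rule_format, of 0] have "poly f 0 = ?F x" by simp
    have "?F x \<noteq> 0" using xf \<open>poly f 0 = ?F x\<close> order_root[of f 0] by auto
    moreover have "?F x = 0"
      using xf(1)[symmetric] secant_triple by (auto simp: pt_eq_iff secant_triple_def spectral_form_scale)
    ultimately show False by simp
  qed
  ultimately show ?thesis by blast
qed

section \<open>Eigenbases and the distinguished point\<close>

text \<open>The derivative at \<open>x\<close> of the characteristic polynomial.\<close>

definition dchar :: "mat3 \<Rightarrow> complex \<Rightarrow> complex" where
  "dchar A x = (x - A$1$1) * (x - A$2$2) - A$1$2 * A$2$1 + ((x - A$1$1) * (x - A$3$3) - A$1$3 * A$3$1)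
     + ((x - A$2$2) * (x - A$3$3) - A$2$3 * A$3$2)"

lemma charpoly_factorization:
  obtains a b c where "\<And>x. det (mat x - A :: mat3) = (x - a) * (x - b) * (x - c)"
    "\<And>x. dchar A x = (x - a) * (x - b) + (x - a) * (x - c) + (x - b) * (x - c)"
proof -
  \<comment> \<open>The sum of the principal 2 by 2 minors, so that \<open>p\<close> is the
    characteristic polynomial.\<close>
  define e2 where "e2 = A$1$1 * A$2$2 - A$1$2 * A$2$1 + (A$1$1 * A$3$3 - A$1$3 * A$3$1)
     + (A$2$2 * A$3$3 - A$2$3 * A$3$2)"
  define p where "p = [:- det A, e2, - (A$1$1 + A$2$2 + A$3$3), 1:]"
  have det: "det (mat x - A) = poly p x" for x
    by (simp add: p_def e2_def det_3 mat_def algebra_simps)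
  have dchar: "dchar A x = poly (pderiv p) x" for x
    by (simp add: p_def e2_def dchar_def pderiv_pCons algebra_simps)
  have "p \<noteq> 0" "degree p = 3" "lead_coeff p = 1" by (simp_all add: p_def)
  then obtain R where R: "size R = 3" "p = (\<Prod>x\<in>#R. [:-x, 1:])"
    using alg_closed_imp_factorization[of p] by auto
  obtain a R1 where "R = add_mset a R1" "size R1 = 2"
    using size_eq_Suc_imp_eq_union[of R 2] R(1) by auto
  moreover obtain b R2 where "R1 = add_mset b R2" "size R2 = 1"
    using size_eq_Suc_imp_eq_union[of R1 1] \<open>size R1 = 2\<close> by auto
  moreover obtain c where "R2 = {#c#}"
    using size_1_singleton_mset[OF \<open>size R2 = 1\<close>] by blast
  ultimately have "R = {#a, b, c#}" by simp
  hence p: "p = [:-a, 1:] * [:-b, 1:] * [:-c, 1:]" using R by (simp add: algebra_simps)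
  have "dchar A x = (x - a) * (x - b) + (x - a) * (x - c) + (x - b) * (x - c)" for x
    unfolding dchar p by (simp add: pderiv_mult pderiv_pCons algebra_simps)
  moreover have "det (mat x - A) = (x - a) * (x - b) * (x - c)" for x
    by (simp add: det p algebra_simps)
  ultimately show ?thesis using that by blast
qed

text \<open>A root at which the derivative does not vanish is simple.\<close>

lemma card_eigenvalues:
  assumes "\<And>x. x \<in> eigenvalues A \<Longrightarrow> dchar A x \<noteq> 0"
  shows "card (eigenvalues A) = 3"
proof -
  obtain a b c where *: "\<And>x. det (mat x - A) = (x - a) * (x - b) * (x - c)"
    "\<And>x. dchar A x = (x - a) * (x - b) + (x - a) * (x - c) + (x - b) * (x - c)"
    by (rule charpoly_factorization[of A]) blast
  have e: "eigenvalues A = {a, b, c}" by (auto simp: eigenvalues_det *(1))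
  with assms have "dchar A a \<noteq> 0" "dchar A b \<noteq> 0" by auto
  hence "a \<noteq> b" "a \<noteq> c" "b \<noteq> c" by (auto simp: *(2))
  thus ?thesis by (simp add: e)
qed

lemma matrix_inv_cancel:
  fixes S :: "'a::semiring_1^'n^'n"
  assumes "invertible S"
  shows "matrix_inv S ** S = mat 1" "S ** matrix_inv S = mat 1"
proof -
  have "\<exists>T. S ** T = mat 1 \<and> T ** S = mat 1" using assms by (simp add: invertible_def)
  from someI_ex[OF this] show "matrix_inv S ** S = mat 1" "S ** matrix_inv S = mat 1"
    by (simp_all add: matrix_inv_def)
qed

text \<open>Combining the moments with the coefficients of a quadratic that vanishes at two nodes
  isolates the unknown at the third.\<close>

lemma vandermonde_kernel:
  fixes x y z a b c :: complex
  assumes "a \<noteq> b" "a \<noteq> c" "b \<noteq> c" "x + y + z = 0" "a * x + b * y + c * z = 0"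
    "a * (a * x) + b * (b * y) + c * (c * z) = 0"
  shows "x = 0 \<and> y = 0 \<and> z = 0"
proof -
  have "(a - b) * (a - c) * x = (a * (a * x) + b * (b * y) + c * (c * z))
      - (b + c) * (a * x + b * y + c * z) + b * c * (x + y + z)"
    "(b - a) * (b - c) * y = (a * (a * x) + b * (b * y) + c * (c * z))
      - (a + c) * (a * x + b * y + c * z) + a * c * (x + y + z)"
    by (simp_all add: algebra_simps)
  hence "x = 0" "y = 0" using assms by simp_all
  thus ?thesis using assms(4) by simp
qed

lemma eigenvalue_ordering_inj:
  "eigenvalue_ordering A h \<Longrightarrow> h i = h j \<longleftrightarrow> i = j"
  by (auto simp: eigenvalue_ordering_def bij_betw_def inj_eq)

lemma eigenvalue_ordering_in: "eigenvalue_ordering A h \<Longrightarrow> h i \<in> eigenvalues A"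
  by (auto simp: eigenvalue_ordering_def bij_betw_def)

lemma eigenbasis_exists:
  assumes h: "eigenvalue_ordering A h"
  shows "\<exists>S. eigenbasis A h S"
proof -
  have "\<forall>i. \<exists>s. s \<noteq> 0 \<and> A *v s = h i *s s"
    using eigenvalue_ordering_in[OF h] by (auto simp: eigenvalues_def)
  then obtain s where s: "\<And>i. s i \<noteq> 0" "\<And>i. A *v s i = h i *s s i" by metis
  define S :: mat3 where "S = (\<chi> i j. s j $ i)"
  define D :: mat3 where "D = (\<chi> i j. if i = j then h i else 0)"
  have AS: "A ** S = S ** D"
  proof -
    have "(A ** S) $ i $ j = (A *v s j) $ i" for i j
      by (simp add: S_def matrix_matrix_mult_def matrix_vector_mult_def)
    moreover have "(S ** D) $ i $ j = (h j *s s j) $ i" for i j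
      using exhaust_3[of j] by (auto simp: S_def D_def matrix_matrix_mult_def sum_3)
    ultimately show ?thesis by (simp add: vec_eq_iff s)
  qed
  have "det S \<noteq> 0"
  proof
    assume "det S = 0"
    then obtain x where x: "x \<noteq> 0" "S *v x = 0" by (auto simp: det_zero_iff_kernel)
    \<comment> \<open>Each application of \<open>A\<close> multiplies the coefficients by the
      eigenvalues. Two applications to \<open>S *v x = 0\<close> give a Vandermonde system in every
      coordinate.\<close>
    have lin: "A *v (a *s s 1 + b *s s 2 + c *s s 3) = (h 1 * a) *s s 1 + (h 2 * b) *s s 2 + (h 3 * c) *s s 3" for a b c
      by (simp add: matrix_vector_right_distrib vector_scalar_commute s mult.commute)
    have 0: "x$1 *s s 1 + x$2 *s s 2 + x$3 *s s 3 = 0"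
      using x(2) by (simp add: S_def vec_eq_iff matrix_vector_mult_def sum_3 mult.commute)
    have 1: "(h 1 * x$1) *s s 1 + (h 2 * x$2) *s s 2 + (h 3 * x$3) *s s 3 = 0"
      using lin[of "x$1" "x$2" "x$3"] 0 by simp
    have 2: "(h 1 * (h 1 * x$1)) *s s 1 + (h 2 * (h 2 * x$2)) *s s 2 + (h 3 * (h 3 * x$3)) *s s 3 = 0"
      using lin[of "h 1 * x$1" "h 2 * x$2" "h 3 * x$3"] 1 by simp
    have "x$1 * s 1 $ i = 0 \<and> x$2 * s 2 $ i = 0 \<and> x$3 * s 3 $ i = 0" for i
      using 0 1 2
      by (intro vandermonde_kernel[of "h 1" "h 2" "h 3"])
         (simp_all add: eigenvalue_ordering_inj[OF h] vec_eq_iff mult.assoc)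
    hence "x$j *s s j = 0" for j using exhaust_3[of j] by (auto simp: vec_eq_iff)
    with s(1) have "x$j = 0" for j by (metis vector_mul_eq_0)
    with x(1) show False by (simp add: vec_eq_iff)
  qed
  hence S: "invertible S" by (simp add: invertible_det_nz)
  have "matrix_inv S ** A ** S = matrix_inv S ** S ** D"
    using AS by (simp add: matrix_mul_assoc[symmetric])
  thus ?thesis using S matrix_inv_cancel[OF S] by (auto simp: eigenbasis_def D_def)
qed

text \<open>In the eigenbasis \<open>\<phi>\<close> is a multiple of the first coordinate, so
  \<open>v\<close> becomes a vector \<open>u\<close> with \<open>u$1 = 0\<close>. The kernel
  equations for \<open>u\<close> determine \<open>L\<close> and \<open>M\<close>, and their solution
  is the explicit formula for the distinguished point.\<close>

lemma eigenbasis_distinguished: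
  assumes h: "eigenvalue_ordering A h" and \<phi>: "\<phi> v* A = h 1 *s \<phi>"
    and d: "cross (normal \<phi> B) (A *v normal \<phi> B) $ 1 \<noteq> 0"
    and S: "eigenbasis A h S" and U: "U = matrix_inv S ** B ** S"
  shows "U$1$2 * U$1$3 \<noteq> 0" "vector [dist_L h U, dist_M h U, 1] = Q_vec A B (normal \<phi> B)"
proof -
  define v where "v = normal \<phi> B"
  define T where "T = matrix_inv S"
  define D :: mat3 where "D = (\<chi> i j. if i = j then h i else 0)"
  define L where "L = Q_vec A B v $ 1"
  define M where "M = Q_vec A B v $ 2"
  have TS: "T ** S = mat 1" and ST: "S ** T = mat 1"
    using S matrix_inv_cancel[of S] by (auto simp: eigenbasis_def T_def)
  have D: "T ** A ** S = D" using S by (simp add: eigenbasis_def T_def D_def)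
  have A: "A ** S = S ** D" and B: "B ** S = S ** U"
    using ST by (simp_all add: D[symmetric] U T_def[symmetric] matrix_mul_assoc)
  define f where "f = \<phi> v* S"
  define u where "u = T *v v"
  have Su: "S *v u = v" by (simp add: u_def matrix_vector_mul_assoc ST)
  have fT: "f v* T = \<phi>" by (simp add: f_def vector_matrix_mul_assoc ST)
  have "f v* D = h 1 *s f"
  proof -
    have "f v* D = \<phi> v* A v* S" by (simp add: f_def vector_matrix_mul_assoc A)
    also have "\<dots> = h 1 *s f" using vmult_combination[of "h 1" \<phi> 0 \<phi> S] by (simp add: \<phi> f_def)
    finally show ?thesis .
  qed
  hence "f$2 * h 2 = h 1 * f$2" "f$3 * h 3 = h 1 * f$3"
    by (simp_all add: vec_eq_iff forall_3 vector_matrix_mult_def D_def sum_3)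
  hence f: "f$2 = 0" "f$3 = 0"
    using eigenvalue_ordering_inj[OF h, of 2 1] eigenvalue_ordering_inj[OF h, of 3 1]
    by (simp_all add: mult.commute)
  have v0: "v \<noteq> 0" using d by (auto simp: v_def)
  have \<phi>0: "\<phi> \<noteq> 0" using v0 by (auto simp: v_def normal_def)
  have f1: "f$1 \<noteq> 0"
  proof
    assume "f$1 = 0"
    with f have "f = 0" by (simp add: vec_eq_iff forall_3)
    with fT \<phi>0 show False by simp
  qed
  have "bil f u = 0" using normal_orthogonal(1)[OF \<phi>] by (simp add: f_def bil_vmult Su v_def)
  hence u1: "u$1 = 0" using f f1 by (simp add: bil_def)
  have not_eig: "A *v v \<noteq> c *s v" for c using d cross_eigenvector_zero[of A v c] by (auto simp: v_def)
  have ADu: "A *v v = S *v (D *v u)" and BUu: "B *v v = S *v (U *v u)"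
    by (simp_all add: Su[symmetric] matrix_vector_mul_assoc A B)
  have Du: "D *v u = vector [0, h 2 * u$2, h 3 * u$3]"
    using u1 by (simp add: vec_eq_iff forall_3 matrix_vector_mult_def D_def sum_3 vector_3)
  \<comment> \<open>With another zero coordinate \<open>u\<close> would be an eigenvector of
    \<open>D\<close>, hence \<open>v\<close> one of \<open>A\<close>, against the nonzero minor
    \<open>d\<close>.\<close>
  have u23: "u$2 \<noteq> 0" "u$3 \<noteq> 0"
  proof -
    have "A *v v = c *s v" if "D *v u = c *s u" for c
      by (simp add: ADu that vector_scalar_commute Su)
    moreover have "D *v u = h 3 *s u" if "u$2 = 0"
      using that u1 by (simp add: Du vec_eq_iff forall_3 vector_3)
    moreover have "D *v u = h 2 *s u" if "u$3 = 0"
      using that u1 by (simp add: Du vec_eq_iff forall_3 vector_3)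
    ultimately show "u$2 \<noteq> 0" "u$3 \<noteq> 0" using not_eig by blast+
  qed
  have Q3: "Q_vec A B v $ 3 = 1" by (simp add: Q_vec_def vector_3)
  have "S *v (L *s u + M *s (D *v u) + U *v u) = 0"
    using Q_vec_kernel[OF \<phi> d] Q3
    by (simp add: pencil_mult matrix_vector_right_distrib vector_scalar_commute Su
        flip: L_def M_def v_def ADu BUu)
  hence "T *v (S *v (L *s u + M *s (D *v u) + U *v u)) = 0" by simp
  hence "L *s u + M *s (D *v u) + U *v u = 0" by (simp add: matrix_vector_mul_assoc TS)
  hence eq: "U$1$2 * u$2 + U$1$3 * u$3 = 0"
    "L * u$2 + M * (h 2 * u$2) + (U$2$2 * u$2 + U$2$3 * u$3) = 0"
    "L * u$3 + M * (h 3 * u$3) + (U$3$2 * u$2 + U$3$3 * u$3) = 0"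
    using u1 by (simp_all add: D_def vec_eq_iff forall_3 matrix_vector_mult_def sum_3)
  \<comment> \<open>Otherwise \<open>\<phi>\<close> would be a left eigenvector of \<open>B\<close>
    too, and \<open>v\<close> would be 0.\<close>
  have "U$1$2 \<noteq> 0 \<or> U$1$3 \<noteq> 0"
  proof (rule ccontr)
    assume "\<not> ?thesis"
    hence "f v* U = U$1$1 *s f"
      using f by (simp add: vec_eq_iff forall_3 vector_matrix_mult_def sum_3 mult.commute)
    hence "f v* U v* T = U$1$1 *s \<phi>" using vmult_combination[of "U$1$1" f 0 f T] by (simp add: fT)
    moreover have "f v* U v* T = \<phi> v* B"
      by (simp add: f_def vector_matrix_mul_assoc B[symmetric]) (simp add: matrix_mul_assoc[symmetric] ST)
    ultimately have "v = 0" by (simp add: v_def normal_def vec_eq_iff forall_3 mult.left_commute)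
    with v0 show False by simp
  qed
  hence U0: "U$1$2 \<noteq> 0" "U$1$3 \<noteq> 0" using eq(1) u23 by auto
  thus "U$1$2 * U$1$3 \<noteq> 0" by simp
  have h23: "h 3 - h 2 \<noteq> 0" using eigenvalue_ordering_inj[OF h, of 3 2] by simp
  \<comment> \<open>The first row of the kernel equation makes \<open>(u$2, u$3)\<close>
    proportional to \<open>(U$1$3, - U$1$2)\<close>.\<close>
  define c where "c = u$2 / U$1$3"
  have uc: "u$2 = c * U$1$3" "u$3 = - (c * U$1$2)" "c \<noteq> 0"
    using U0 u23 eq(1) by (simp_all add: c_def field_simps eq_neg_iff_add_eq_0)
  have "c * (L * U$1$3 + M * (h 2 * U$1$3) + (U$2$2 * U$1$3 - U$2$3 * U$1$2)) = 0"
    "c * (- L * U$1$2 - M * (h 3 * U$1$2) + (U$3$2 * U$1$3 - U$3$3 * U$1$2)) = 0"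
    using eq(2,3) unfolding uc by (simp_all add: algebra_simps)
  hence "L * U$1$3 + M * (h 2 * U$1$3) + (U$2$2 * U$1$3 - U$2$3 * U$1$2) = 0"
    "- L * U$1$2 - M * (h 3 * U$1$2) + (U$3$2 * U$1$3 - U$3$3 * U$1$2) = 0"
    using uc(3) unfolding mult_eq_0_iff by blast+
  hence E: "U$1$2 * U$2$3 - U$1$3 * U$2$2 = U$1$3 * (L + M * h 2)"
    "U$1$2 * U$3$3 - U$1$3 * U$3$2 = - (U$1$2 * (L + M * h 3))"
    by algebra+
  have "dist_L h U = L" "dist_M h U = M"
    unfolding dist_L_def dist_M_def E using U0 h23 by (simp_all add: divide_simps) (simp_all add: algebra_simps)
  thus "vector [dist_L h U, dist_M h U, 1] = Q_vec A B (normal \<phi> B)"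
    by (simp add: vec_eq_iff forall_3 vector_3 L_def M_def v_def) (simp add: Q_vec_def vector_3)
qed

text \<open>The right-hand side does not mention the eigenbasis, so the distinguished point exists
  and is independent of that choice.\<close>

lemma distinguished_point_iff:
  assumes "eigenvalue_ordering A h" "\<phi> v* A = h 1 *s \<phi>"
    and "cross (normal \<phi> B) (A *v normal \<phi> B) $ 1 \<noteq> 0"
  shows "distinguished_point A B h Z \<longleftrightarrow> Z = pt (Q_vec A B (normal \<phi> B))"
  using eigenbasis_distinguished[OF assms] eigenbasis_exists[OF assms(1)] assms(1)
  unfolding distinguished_point_def by metis

section \<open>Eliminating the eigenvalues\<close>

text \<open>The first row of the adjugate of \<open>mat h - A\<close>.\<close>

definition eigrow :: "mat3 \<Rightarrow> complex \<Rightarrow> complex^3" where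
  "eigrow A h = cross (vector [- A$1$2, h - A$2$2, - A$3$2]) (vector [- A$1$3, - A$2$3, h - A$3$3])"

text \<open>The row is the cross product of the last two columns of \<open>mat h - A\<close>. It
  therefore annihilates these, and its product with the first column is the determinant, which is
  0.\<close>

lemma eigrow_eigenvector:
  assumes "h \<in> eigenvalues A" shows "eigrow A h v* A = h *s eigrow A h"
proof -
  have "det (mat h - A) = 0" using assms by (simp add: eigenvalues_det)
  hence "h * eigrow A h $ 1 - (eigrow A h v* A) $ 1 = 0"
    by (simp add: eigrow_def vector_3 vector_matrix_mult_def sum_3 det_3 mat_def algebra_simps)
  moreover have "h * eigrow A h $ 2 - (eigrow A h v* A) $ 2 = 0" "h * eigrow A h $ 3 - (eigrow A h v* A) $ 3 = 0"
    by (simp_all add: eigrow_def vector_3 vector_matrix_mult_def sum_3 algebra_simps)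
  ultimately show ?thesis by (simp add: vec_eq_iff forall_3)
qed

text \<open>The two extra variables stand for eigenvalues of the first and the second matrix, which
  are not polynomial in the entries. The inductive form lets matrices be substituted for them by
  induction.\<close>

inductive poly_fun2 :: "(mat3 \<times> mat3 \<Rightarrow> complex \<Rightarrow> complex \<Rightarrow> complex) \<Rightarrow> bool" where
  poly_fun2_const: "poly_fun2 (\<lambda>_ _ _. c)"
| poly_fun2_fst_entry: "poly_fun2 (\<lambda>p _ _. fst p $ i $ j)"
| poly_fun2_snd_entry: "poly_fun2 (\<lambda>p _ _. snd p $ i $ j)"
| poly_fun2_var1: "poly_fun2 (\<lambda>_ s _. s)"
| poly_fun2_var2: "poly_fun2 (\<lambda>_ _ t. t)"
| poly_fun2_add: "poly_fun2 f \<Longrightarrow> poly_fun2 g \<Longrightarrow> poly_fun2 (\<lambda>p s t. f p s t + g p s t)"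
| poly_fun2_mult: "poly_fun2 f \<Longrightarrow> poly_fun2 g \<Longrightarrow> poly_fun2 (\<lambda>p s t. f p s t * g p s t)"

lemma poly_fun2_uminus: "poly_fun2 f \<Longrightarrow> poly_fun2 (\<lambda>p s t. - f p s t)"
  by (drule poly_fun2_mult[OF poly_fun2_const[of "-1"]]) simp

lemma poly_fun2_diff:
  assumes "poly_fun2 f" "poly_fun2 g" shows "poly_fun2 (\<lambda>p s t. f p s t - g p s t)"
  using poly_fun2_add[OF assms(1) poly_fun2_uminus[OF assms(2)]] by simp

definition poly_fun2_vec :: "(mat3 \<times> mat3 \<Rightarrow> complex \<Rightarrow> complex \<Rightarrow> complex^3) \<Rightarrow> bool" where
  "poly_fun2_vec w \<longleftrightarrow> (\<forall>i. poly_fun2 (\<lambda>p s t. w p s t $ i))"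

definition poly_fun2_mat :: "(mat3 \<times> mat3 \<Rightarrow> complex \<Rightarrow> complex \<Rightarrow> mat3) \<Rightarrow> bool" where
  "poly_fun2_mat M \<longleftrightarrow> (\<forall>i j. poly_fun2 (\<lambda>p s t. M p s t $ i $ j))"

lemma poly_fun2_vec_nth: "poly_fun2_vec w \<Longrightarrow> poly_fun2 (\<lambda>p s t. w p s t $ i)"
  by (simp add: poly_fun2_vec_def)

lemma poly_fun2_mat_fst: "poly_fun2_mat (\<lambda>p _ _. fst p)" and poly_fun2_mat_snd: "poly_fun2_mat (\<lambda>p _ _. snd p)"
  by (simp_all add: poly_fun2_mat_def poly_fun2_fst_entry poly_fun2_snd_entry)

lemmas poly_fun2_arith =
  poly_fun2_const poly_fun2_var1 poly_fun2_var2 poly_fun2_add poly_fun2_mult poly_fun2_uminus poly_fun2_diff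

lemma poly_fun2_vec_vector:
  "poly_fun2 f \<Longrightarrow> poly_fun2 g \<Longrightarrow> poly_fun2 h \<Longrightarrow> poly_fun2_vec (\<lambda>p s t. vector [f p s t, g p s t, h p s t])"
  by (simp add: poly_fun2_vec_def forall_3 vector_3)

lemma poly_fun2_bil: "poly_fun2_vec v \<Longrightarrow> poly_fun2_vec w \<Longrightarrow> poly_fun2 (\<lambda>p s t. bil (v p s t) (w p s t))"
  unfolding bil_def by (intro poly_fun2_arith) (simp_all add: poly_fun2_vec_def)

lemma poly_fun2_vec_cross: "poly_fun2_vec v \<Longrightarrow> poly_fun2_vec w \<Longrightarrow> poly_fun2_vec (\<lambda>p s t. cross (v p s t) (w p s t))"
  unfolding cross_def by (intro poly_fun2_vec_vector poly_fun2_arith) (simp_all add: poly_fun2_vec_def)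

lemma poly_fun2_vec_vmult: "poly_fun2_vec v \<Longrightarrow> poly_fun2_mat M \<Longrightarrow> poly_fun2_vec (\<lambda>p s t. v p s t v* M p s t)"
  by (simp add: poly_fun2_vec_def poly_fun2_mat_def vector_matrix_mult_def sum_3 poly_fun2_add poly_fun2_mult)

lemma poly_fun2_vec_mult: "poly_fun2_vec v \<Longrightarrow> poly_fun2_mat M \<Longrightarrow> poly_fun2_vec (\<lambda>p s t. M p s t *v v p s t)"
  by (simp add: poly_fun2_vec_def poly_fun2_mat_def matrix_vector_mult_def sum_3 poly_fun2_add poly_fun2_mult)

lemma poly_fun2_det: "poly_fun2_mat M \<Longrightarrow> poly_fun2 (\<lambda>p s t. det (M p s t))"
  unfolding det_3 by (intro poly_fun2_arith) (simp_all add: poly_fun2_mat_def)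

lemma poly_fun2_spectral_form:
  assumes "poly_fun2_mat X" "poly_fun2_mat Y" "poly_fun2_vec v"
  shows "poly_fun2 (\<lambda>p s t. spectral_form (X p s t) (Y p s t) (v p s t))"
proof -
  have "poly_fun2 (\<lambda>p s t. if i = j then v p s t $ 1 else 0)" for i j :: 3
    using assms(3) by (cases "i = j") (simp_all add: poly_fun2_const poly_fun2_vec_def)
  hence "poly_fun2_mat (\<lambda>p s t. pencil (X p s t) (Y p s t) (v p s t))"
    unfolding poly_fun2_mat_def pencil_nth using assms
    by (intro allI poly_fun2_add poly_fun2_mult) (simp_all add: poly_fun2_mat_def poly_fun2_vec_def)
  thus ?thesis unfolding spectral_form_pencil by (rule poly_fun2_det)
qed

lemma poly_fun2_obstruction:
  assumes "poly_fun2_mat X" "poly_fun2_mat Y" "poly_fun2_vec \<phi>" "poly_fun2_vec \<psi>" "poly_fun2 x" "poly_fun2 y"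
  shows "poly_fun2 (\<lambda>p s t. obstruction (\<phi> p s t) (\<psi> p s t) (X p s t) (Y p s t) (x p s t) (y p s t))"
  unfolding obstruction_def Let_def weight_def row_coeff_def image_coeff_def normal_def using assms
  by (intro poly_fun2_add poly_fun2_mult poly_fun2_uminus poly_fun2_bil poly_fun2_vec_cross
      poly_fun2_vec_vmult poly_fun2_vec_mult poly_fun2_spectral_form poly_fun2_vec_vector
      poly_fun2_const poly_fun2_vec_nth) simp_all

lemma poly_fun2_vec_eigrow: "poly_fun2_mat X \<Longrightarrow> poly_fun2 x \<Longrightarrow> poly_fun2_vec (\<lambda>p s t. eigrow (X p s t) (x p s t))"
  unfolding eigrow_def by (intro poly_fun2_vec_cross poly_fun2_vec_vector poly_fun2_arith) (simp_all add: poly_fun2_mat_def)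

lemma poly_fun2_dchar: "poly_fun2_mat X \<Longrightarrow> poly_fun2 x \<Longrightarrow> poly_fun2 (\<lambda>p s t. dchar (X p s t) (x p s t))"
  unfolding dchar_def by (intro poly_fun2_arith) (simp_all add: poly_fun2_mat_def)

section \<open>Substitution of the matrices for their eigenvalues\<close>

lemma scalar_matrix_mult_vec: "mat c *v x = c *s (x :: complex^3)"
  by (simp add: vec_eq_iff forall_3 matrix_vector_mult_def mat_def sum_3)

lemma poly_fun2_mat_scalar: "poly_fun2 f \<Longrightarrow> poly_fun2_mat (\<lambda>p s t. mat (f p s t))"
  unfolding poly_fun2_mat_def mat_def
proof (intro allI)
  fix i j :: 3 assume "poly_fun2 f"
  thus "poly_fun2 (\<lambda>p s t. (\<chi> i j. if i = j then f p s t else 0) $ i $ j)"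
    by (cases "i = j") (simp_all add: poly_fun2_const)
qed

text \<open>Substituting the matrix \<open>B\<close> for the variable \<open>t\<close> turns \<open>g\<close> into a matrix that acts on every eigenvector
  of \<open>B\<close> by the corresponding value of \<open>g\<close>; its determinant is the product of these values.\<close>

lemma poly_fun2_substitute_snd:
  assumes "poly_fun2 g"
  shows "\<exists>M. poly_fun2_mat (\<lambda>p s t. M p s) \<and>
    (\<forall>p s t x. snd p *v x = t *s x \<longrightarrow> M p s *v x = g p s t *s x)"
  using assms
proof induction
  case (poly_fun2_const c)
  show ?case using poly_fun2_mat_scalar[OF poly_fun2.poly_fun2_const[of c]]
    by (intro exI[of _ "\<lambda>_ _. mat c"]) (simp add: scalar_matrix_mult_vec)
next
  case (poly_fun2_fst_entry i j)
  show ?case using poly_fun2_mat_scalar[OF poly_fun2.poly_fun2_fst_entry[of i j]]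
    by (intro exI[of _ "\<lambda>p _. mat (fst p $ i $ j)"]) (simp add: scalar_matrix_mult_vec)
next
  case (poly_fun2_snd_entry i j)
  show ?case using poly_fun2_mat_scalar[OF poly_fun2.poly_fun2_snd_entry[of i j]]
    by (intro exI[of _ "\<lambda>p _. mat (snd p $ i $ j)"]) (simp add: scalar_matrix_mult_vec)
next
  case poly_fun2_var1
  show ?case using poly_fun2_mat_scalar[OF poly_fun2.poly_fun2_var1]
    by (intro exI[of _ "\<lambda>_ s. mat s"]) (simp add: scalar_matrix_mult_vec)
next
  case poly_fun2_var2
  show ?case by (intro exI[of _ "\<lambda>p _. snd p"]) (simp add: poly_fun2_mat_snd)
next
  case (poly_fun2_add f g)
  then obtain M N where MN:
    "poly_fun2_mat (\<lambda>p s t. M p s)" "\<And>p s t x. snd p *v x = t *s x \<Longrightarrow> M p s *v x = f p s t *s x"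
    "poly_fun2_mat (\<lambda>p s t. N p s)" "\<And>p s t x. snd p *v x = t *s x \<Longrightarrow> N p s *v x = g p s t *s x"
    by blast
  show ?case
  proof (intro exI[of _ "\<lambda>p s. M p s + N p s"] conjI allI impI)
    show "poly_fun2_mat (\<lambda>p s t. M p s + N p s)" using MN(1,3) by (simp add: poly_fun2_mat_def poly_fun2.poly_fun2_add)
    fix p :: "mat3 \<times> mat3" and s t and x :: "complex^3" assume "snd p *v x = t *s x"
    from MN(2)[OF this] MN(4)[OF this]
    show "(M p s + N p s) *v x = (f p s t + g p s t) *s x"
      by (simp add: matrix_vector_mult_add_rdistrib vector_sadd_rdistrib)
  qed
next
  case (poly_fun2_mult f g)
  then obtain M N where MN:
    "poly_fun2_mat (\<lambda>p s t. M p s)" "\<And>p s t x. snd p *v x = t *s x \<Longrightarrow> M p s *v x = f p s t *s x"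
    "poly_fun2_mat (\<lambda>p s t. N p s)" "\<And>p s t x. snd p *v x = t *s x \<Longrightarrow> N p s *v x = g p s t *s x"
    by blast
  have "poly_fun2 (\<lambda>p s t. (M p s ** N p s) $ i $ j)" for i j
    using MN(1,3) by (simp add: matrix_matrix_mult_def sum_3 poly_fun2_mat_def poly_fun2.poly_fun2_add poly_fun2.poly_fun2_mult)
  moreover have "(M p s ** N p s) *v x = (f p s t * g p s t) *s x" if "snd p *v x = t *s x" for p :: "mat3 \<times> mat3" and s t and x :: "complex^3"
    using MN(2)[OF that] MN(4)[OF that]
    by (simp add: vector_scalar_commute mult.commute flip: matrix_vector_mul_assoc)
  ultimately show ?case unfolding poly_fun2_mat_def by (intro exI[of _ "\<lambda>p s. M p s ** N p s"]) blast
qed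

lemma poly_fun_scalar: "poly_fun f \<Longrightarrow> poly_fun (\<lambda>p. (mat (f p) :: mat3) $ i $ j)"
  by (cases "i = j") (simp_all add: mat_def poly_fun.const)

lemma poly_fun_matrix_mult:
  fixes M N :: "mat3 \<times> mat3 \<Rightarrow> mat3"
  assumes "\<And>i j. poly_fun (\<lambda>p. M p $ i $ j)" "\<And>i j. poly_fun (\<lambda>p. N p $ i $ j)"
  shows "poly_fun (\<lambda>p. (M p ** N p) $ i $ j)"
  using assms by (simp add: matrix_matrix_mult_def sum_3 poly_fun.add poly_fun.mult)

text \<open>The analogous substitution for \<open>s\<close>. It is applied to a determinant that
  contains no \<open>t\<close>, so 0 is an arbitrary value there.\<close>

lemma poly_fun2_substitute_fst:
  assumes "poly_fun2 g"
  shows "\<exists>M. (\<forall>i j. poly_fun (\<lambda>p. M p $ i $ j)) \<and>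
    (\<forall>p s x. fst p *v x = s *s x \<longrightarrow> M p *v x = g p s 0 *s x)"
  using assms
proof induction
  case (poly_fun2_const c)
  show ?case using poly_fun_scalar[OF poly_fun.const[of c]]
    by (intro exI[of _ "\<lambda>_. mat c"]) (simp add: scalar_matrix_mult_vec)
next
  case (poly_fun2_fst_entry i j)
  show ?case using poly_fun_scalar[OF poly_fun.fst_entry[of i j]]
    by (intro exI[of _ "\<lambda>p. mat (fst p $ i $ j)"]) (simp add: scalar_matrix_mult_vec)
next
  case (poly_fun2_snd_entry i j)
  show ?case using poly_fun_scalar[OF poly_fun.snd_entry[of i j]]
    by (intro exI[of _ "\<lambda>p. mat (snd p $ i $ j)"]) (simp add: scalar_matrix_mult_vec)
next
  case poly_fun2_var1
  show ?case by (intro exI[of _ fst]) (simp add: poly_fun.fst_entry)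
next
  case poly_fun2_var2
  show ?case using poly_fun_scalar[OF poly_fun.const[of 0]]
    by (intro exI[of _ "\<lambda>_. mat 0"]) (simp add: scalar_matrix_mult_vec)
next
  case (poly_fun2_add f g)
  then obtain M N where MN:
    "\<And>i j. poly_fun (\<lambda>p. M p $ i $ j)" "\<And>p s x. fst p *v x = s *s x \<Longrightarrow> M p *v x = f p s 0 *s x"
    "\<And>i j. poly_fun (\<lambda>p. N p $ i $ j)" "\<And>p s x. fst p *v x = s *s x \<Longrightarrow> N p *v x = g p s 0 *s x"
    by blast
  show ?case
  proof (intro exI[of _ "\<lambda>p. M p + N p"] conjI allI impI)
    show "poly_fun (\<lambda>p. (M p + N p) $ i $ j)" for i j using MN(1,3) by (simp add: poly_fun.add)
    fix p :: "mat3 \<times> mat3" and s and x :: "complex^3" assume "fst p *v x = s *s x"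
    from MN(2)[OF this] MN(4)[OF this]
    show "(M p + N p) *v x = (f p s 0 + g p s 0) *s x"
      by (simp add: matrix_vector_mult_add_rdistrib vector_sadd_rdistrib)
  qed
next
  case (poly_fun2_mult f g)
  then obtain M N where MN:
    "\<And>i j. poly_fun (\<lambda>p. M p $ i $ j)" "\<And>p s x. fst p *v x = s *s x \<Longrightarrow> M p *v x = f p s 0 *s x"
    "\<And>i j. poly_fun (\<lambda>p. N p $ i $ j)" "\<And>p s x. fst p *v x = s *s x \<Longrightarrow> N p *v x = g p s 0 *s x"
    by blast
  have "(M p ** N p) *v x = (f p s 0 * g p s 0) *s x" if "fst p *v x = s *s x" for p :: "mat3 \<times> mat3" and s and x :: "complex^3"
    using MN(2)[OF that] MN(4)[OF that]
    by (simp add: vector_scalar_commute mult.commute flip: matrix_vector_mul_assoc)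
  with poly_fun_matrix_mult[of M N, OF MN(1,3)] show ?case by (intro exI[of _ "\<lambda>p. M p ** N p"]) blast
qed

lemma poly_fun_det:
  fixes M :: "mat3 \<times> mat3 \<Rightarrow> mat3"
  assumes "\<And>i j. poly_fun (\<lambda>p. M p $ i $ j)"
  shows "poly_fun (\<lambda>p. det (M p))"
proof -
  have diff: "poly_fun (\<lambda>p. f p - g p)" if "poly_fun f" "poly_fun g" for f g
    using poly_fun.add[OF that(1) poly_fun.mult[OF poly_fun.const[of "-1"] that(2)]] by simp
  show ?thesis unfolding det_3 by (intro diff poly_fun.add poly_fun.mult assms)
qed

text \<open>In an eigenbasis of \<open>A\<close> the matrix \<open>M\<close> is diagonal with the
  entries \<open>c i\<close>.\<close>

lemma det_nonzero_on_eigenvectors: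
  assumes h: "eigenvalue_ordering A h"
    and M: "\<And>i x. A *v x = h i *s x \<Longrightarrow> M *v x = c i *s x" and c: "\<And>i. c i \<noteq> 0"
  shows "det M \<noteq> 0"
proof -
  obtain S where S: "eigenbasis A h S" using eigenbasis_exists[OF h] by blast
  define D where "D d = ((\<chi> i j. if i = j then d i else 0) :: mat3)" for d :: "3 \<Rightarrow> complex"
  have inv: "invertible S" and Dh: "D h = matrix_inv S ** A ** S"
    using S by (simp_all add: eigenbasis_def D_def)
  have AS: "A ** S = S ** D h" by (simp add: Dh matrix_mul_assoc matrix_inv_cancel[OF inv])
  have col: "N *v column j S = d j *s column j S \<longleftrightarrow> (\<forall>i. (N ** S) $ i $ j = (S ** D d) $ i $ j)" for N d j
  proof -
    have "(S ** D d) $ i $ j = d j * S $ i $ j" for i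
      using exhaust_3[of j] by (auto simp: matrix_matrix_mult_def D_def sum_3)
    thus ?thesis by (simp add: vec_eq_iff column_def matrix_vector_mult_def matrix_matrix_mult_def)
  qed
  have "A *v column j S = h j *s column j S" for j using AS by (simp add: col)
  hence "M *v column j S = c j *s column j S" for j using M by blast
  hence "(M ** S) $ i $ j = (S ** D c) $ i $ j" for i j using col by blast
  hence "M ** S = S ** D c" by (simp add: vec_eq_iff)
  hence "det M * det S = det S * det (D c)" by (metis det_mul)
  moreover have "det (D c) = c 1 * c 2 * c 3" by (simp add: det_3 D_def)
  moreover have "det S \<noteq> 0" using inv by (simp add: invertible_det_nz)
  ultimately show ?thesis using c by auto
qed

text \<open>When both spectra consist of three distinct values, \<open>f\<close> is the product of
  \<open>g\<close> over all nine pairs of eigenvalues. The first property turns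
  \<open>f \<noteq> 0\<close> into genericity at every pair; the second shows that \<open>f\<close>
  does not vanish at the explicit example.\<close>

lemma eigenvalue_elimination:
  assumes g: "poly_fun2 g"
  obtains f where "poly_fun f"
    "\<And>A B s t. f (A, B) \<noteq> 0 \<Longrightarrow> s \<in> eigenvalues A \<Longrightarrow> t \<in> eigenvalues B \<Longrightarrow> g (A, B) s t \<noteq> 0"
    "\<And>A B h \<xi>. eigenvalue_ordering A h \<Longrightarrow> eigenvalue_ordering B \<xi> \<Longrightarrow>
       (\<And>i j. g (A, B) (h i) (\<xi> j) \<noteq> 0) \<Longrightarrow> f (A, B) \<noteq> 0"
proof -
  from poly_fun2_substitute_snd[OF g] obtain N where N: "poly_fun2_mat (\<lambda>p s t. N p s) \<and>
    (\<forall>p s t x. snd p *v x = t *s x \<longrightarrow> N p s *v x = g p s t *s x)" ..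
  from poly_fun2_substitute_fst[OF poly_fun2_det[OF conjunct1[OF N]]]
  obtain M where M: "(\<forall>i j. poly_fun (\<lambda>p. M p $ i $ j)) \<and>
    (\<forall>p s x. fst p *v x = s *s x \<longrightarrow> M p *v x = det (N p s) *s x)" ..
  have Nx: "N (A, B) s *v x = g (A, B) s t *s x" if "B *v x = t *s x" for A B s t x
    using conjunct2[OF N, rule_format, of "(A, B)"] that by simp
  have Mx: "M (A, B) *v x = det (N (A, B) s) *s x" if "A *v x = s *s x" for A B s x
    using conjunct2[OF M, rule_format, of "(A, B)"] that by simp
  show ?thesis
  proof (rule that[of "\<lambda>p. det (M p)"])
    show "poly_fun (\<lambda>p. det (M p))" by (rule poly_fun_det) (rule conjunct1[OF M, rule_format])
  next
    fix A B s t assume *: "det (M (A, B)) \<noteq> 0" "s \<in> eigenvalues A" "t \<in> eigenvalues B"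
    from *(2) obtain x where x: "x \<noteq> 0" "A *v x = s *s x" by (auto simp: eigenvalues_def)
    from *(3) obtain y where y: "y \<noteq> 0" "B *v y = t *s y" by (auto simp: eigenvalues_def)
    show "g (A, B) s t \<noteq> 0"
    proof
      assume "g (A, B) s t = 0"
      with Nx[OF y(2)] have "N (A, B) s *v y = 0" by simp
      with y(1) have "det (N (A, B) s) = 0" unfolding det_zero_iff_kernel by blast
      with Mx[OF x(2)] have "M (A, B) *v x = 0" by simp
      with x(1) *(1) show False unfolding det_zero_iff_kernel by blast
    qed
  next
    fix A B h \<xi> assume *: "eigenvalue_ordering A h" "eigenvalue_ordering B \<xi>"
      "\<And>i j. g (A, B) (h i) (\<xi> j) \<noteq> 0"
    have "det (N (A, B) (h i)) \<noteq> 0" for i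
      by (rule det_nonzero_on_eigenvectors[OF *(2) Nx *(3)])
    from det_nonzero_on_eigenvectors[OF *(1) Mx this]
    show "det (M (A, B)) \<noteq> 0" .
  qed
qed

section \<open>Simultaneous conjugation\<close>

lemma invertible_matrix_inv:
  fixes S :: mat3
  assumes "invertible S"
  shows "invertible (matrix_inv S)" "matrix_inv (matrix_inv S) = S"
proof -
  note S = matrix_inv_cancel[OF assms]
  show inv: "invertible (matrix_inv S)" using S by (auto simp: invertible_def)
  have "S ** (matrix_inv S ** matrix_inv (matrix_inv S)) = S"
    by (simp add: matrix_inv_cancel[OF inv])
  thus "matrix_inv (matrix_inv S) = S" by (simp add: matrix_mul_assoc S)
qed

lemma matrix_inv_mult:
  fixes S R :: mat3
  assumes S: "invertible S" and R: "invertible R"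
  shows "invertible (S ** R)" "matrix_inv (S ** R) = matrix_inv R ** matrix_inv S"
proof -
  show inv: "invertible (S ** R)" using S R by (simp add: invertible_det_nz det_mul)
  have "matrix_inv (S ** R) ** (S ** R) ** (matrix_inv R ** matrix_inv S)
      = matrix_inv (S ** R) ** (S ** ((R ** matrix_inv R) ** matrix_inv S))"
    by (simp only: matrix_mul_assoc)
  thus "matrix_inv (S ** R) = matrix_inv R ** matrix_inv S"
    by (simp add: matrix_inv_cancel[OF inv] matrix_inv_cancel[OF S] matrix_inv_cancel[OF R])
qed

definition mat_conj :: "mat3 \<Rightarrow> mat3 \<Rightarrow> mat3" where
  "mat_conj S A = S ** A ** matrix_inv S"

lemma conj_mult_vec: "invertible S \<Longrightarrow> mat_conj S A *v (S *v x) = S *v (A *v x)"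
proof -
  assume S: "invertible S"
  have "mat_conj S A ** S = S ** A"
    using matrix_inv_cancel(1)[OF S] by (simp add: mat_conj_def flip: matrix_mul_assoc)
  thus ?thesis by (simp add: matrix_vector_mul_assoc)
qed

lemma conj_conj:
  assumes "invertible S" "invertible R" shows "mat_conj S (mat_conj R A) = mat_conj (S ** R) A"
  by (simp add: mat_conj_def matrix_inv_mult(2)[OF assms] matrix_mul_assoc)

lemma mat_conj_one [simp]: "mat_conj (mat 1) A = A"
  using matrix_inv_cancel(1)[of "mat 1 :: mat3"] by (simp add: mat_conj_def invertible_det_nz)

lemma mat_conj_inverse:
  assumes S: "invertible S" shows "mat_conj (matrix_inv S) (mat_conj S A) = A"
proof -
  show ?thesis
    by (simp add: conj_conj[OF invertible_matrix_inv(1)[OF S] S] matrix_inv_cancel[OF S])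
qed

lemma invertible_conj: "invertible S \<Longrightarrow> invertible A \<Longrightarrow> invertible (mat_conj S A)"
  by (simp add: mat_conj_def matrix_inv_mult invertible_matrix_inv)

lemma spectral_form_conj:
  assumes S: "invertible S"
  shows "spectral_form (mat_conj S A) (mat_conj S B) = spectral_form A B"
proof
  fix v
  have "pencil (mat_conj S A) (mat_conj S B) v *v (S *v x) = S *v (pencil A B v *v x)" for x
    by (simp add: pencil_mult conj_mult_vec[OF S] matrix_vector_right_distrib vector_scalar_commute)
  hence "pencil (mat_conj S A) (mat_conj S B) v ** S = S ** pencil A B v"
    by (simp add: matrix_eq matrix_vector_mul_assoc)
  hence "det (pencil (mat_conj S A) (mat_conj S B) v) * det S = det S * det (pencil A B v)"
    by (metis det_mul)
  moreover have "det S \<noteq> 0" using S by (simp add: invertible_det_nz)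
  ultimately show "spectral_form (mat_conj S A) (mat_conj S B) v = spectral_form A B v"
    by (simp add: spectral_form_pencil)
qed

lemma eigenvalues_spectral_form: "eigenvalues A = {c. spectral_form A B (vector [c, -1, 0]) = 0}"
proof -
  have "pencil A B (vector [c, -1, 0]) = mat c - A" for c
    by (simp add: vec_eq_iff pencil_nth mat_def vector_3)
  thus ?thesis by (simp add: eigenvalues_det spectral_form_pencil)
qed

lemma eigenvalues_conj: "invertible S \<Longrightarrow> eigenvalues (mat_conj S A) = eigenvalues A"
  by (simp add: eigenvalues_spectral_form[of "mat_conj S A" "mat_conj S A"]
      eigenvalues_spectral_form[of A A] spectral_form_conj)

text \<open>If \<open>R\<close> is an eigenbasis of \<open>A\<close>, then \<open>S ** R\<close> is
  one of the conjugate, and the matrix \<open>U\<close> stays the same.\<close>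

lemma distinguished_point_conjI:
  assumes S: "invertible S" and "distinguished_point A B h Z"
  shows "distinguished_point (mat_conj S A) (mat_conj S B) h Z"
proof -
  from assms(2) obtain R U where R: "eigenbasis A h R" "U = matrix_inv R ** B ** R"
    "U$1$2 * U$1$3 \<noteq> 0" "Z = pt (vector [dist_L h U, dist_M h U, 1])"
    and h: "eigenvalue_ordering A h" by (auto simp: distinguished_point_def)
  have inv: "invertible R" using R(1) by (simp add: eigenbasis_def)
  note SR = matrix_inv_mult[OF S inv]
  have *: "matrix_inv (S ** R) ** mat_conj S X ** (S ** R) = matrix_inv R ** X ** R" for X
  proof -
    have "matrix_inv (S ** R) ** mat_conj S X ** (S ** R)
        = matrix_inv R ** ((matrix_inv S ** S) ** X ** (matrix_inv S ** S)) ** R"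
      unfolding SR(2) mat_conj_def by (simp only: matrix_mul_assoc)
    thus ?thesis by (simp add: matrix_inv_cancel[OF S])
  qed
  have "eigenbasis (mat_conj S A) h (S ** R)" using R(1) SR(1) by (simp add: eigenbasis_def *)
  moreover have "eigenvalue_ordering (mat_conj S A) h"
    using h by (simp add: eigenvalue_ordering_def eigenvalues_conj[OF S])
  ultimately show ?thesis unfolding distinguished_point_def using R(2-4) * by metis
qed

lemma distinguished_point_conj:
  assumes S: "invertible S"
  shows "distinguished_point (mat_conj S A) (mat_conj S B) h Z \<longleftrightarrow> distinguished_point A B h Z"
  using distinguished_point_conjI[OF S]
    distinguished_point_conjI[OF invertible_matrix_inv(1)[OF S], of "mat_conj S A" "mat_conj S B"]
  by (auto simp: mat_conj_inverse[OF S])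

lemma poly_fun_conj:
  assumes "poly_fun f"
  shows "poly_fun (\<lambda>p. f (mat_conj S (fst p), mat_conj S (snd p)))"
  using assms
proof induction
  case (fst_entry i j)
  show ?case
    by (simp add: mat_conj_def matrix_matrix_mult_def sum_3)
       (intro poly_fun.add poly_fun.mult poly_fun.const poly_fun.fst_entry)
next
  case (snd_entry i j)
  show ?case
    by (simp add: mat_conj_def matrix_matrix_mult_def sum_3)
       (intro poly_fun.add poly_fun.mult poly_fun.const poly_fun.snd_entry)
qed (auto intro: poly_fun.intros)

text \<open>Saturating under conjugation makes an open set invariant, so that the defining polynomial need not be.\<close>

lemma zariski_open_saturation:
  assumes f: "poly_fun f"
  defines "G \<equiv> {p \<in> GL3_pairs. \<exists>S. invertible S \<and> f (mat_conj S (fst p), mat_conj S (snd p)) \<noteq> 0}"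
  shows "zariski_open G" "p \<in> G \<Longrightarrow> sim_conj p q \<Longrightarrow> q \<in> G"
proof -
  let ?F = "(\<lambda>S p. f (mat_conj S (fst p), mat_conj S (snd p))) ` {S. invertible S}"
  have "\<forall>g\<in>?F. poly_fun g" using poly_fun_conj[OF f] by blast
  moreover have "G = {p \<in> GL3_pairs. \<exists>g\<in>?F. g p \<noteq> 0}" by (auto simp: G_def)
  ultimately show "zariski_open G" unfolding zariski_open_def by blast
  assume p: "p \<in> G" and "sim_conj p q"
  then obtain R where R: "invertible R" and q: "q = (mat_conj R (fst p), mat_conj R (snd p))"
    by (auto simp: sim_conj_def mat_conj_def)
  from p obtain S where S: "invertible S" "f (mat_conj S (fst p), mat_conj S (snd p)) \<noteq> 0"
    by (auto simp: G_def)
  note R' = invertible_matrix_inv(1)[OF R]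
  have "mat_conj (S ** matrix_inv R) (mat_conj R X) = mat_conj S X" for X
    using conj_conj[OF S(1) R', of "mat_conj R X"] by (simp add: mat_conj_inverse[OF R])
  hence "f (mat_conj (S ** matrix_inv R) (fst q), mat_conj (S ** matrix_inv R) (snd q)) \<noteq> 0"
    using S(2) by (simp add: q)
  moreover have "q \<in> GL3_pairs"
    using p R by (auto simp: G_def GL3_pairs_def q invertible_conj)
  ultimately show "q \<in> G" using matrix_inv_mult(1)[OF S(1) R'] by (auto simp: G_def)
qed

section \<open>Transposing the two matrices\<close>

lemma swap23_nth [simp]: "swap23 v $ 1 = v$1" "swap23 v $ 2 = v$3" "swap23 v $ 3 = v$2"
  by (simp_all add: swap23_def vector_3)

lemma swap23_swap23 [simp]: "swap23 (swap23 v) = v"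
  by (simp add: vec_eq_iff forall_3)

lemma swap23_combination: "swap23 (a *s x + b *s y) = a *s swap23 x + b *s swap23 y"
  by (simp add: vec_eq_iff forall_3)

lemma swap23_image_pt: "swap23 ` pt v = pt (swap23 v)"
proof -
  have "swap23 (c *s x) = c *s swap23 x" for c x by (simp add: vec_eq_iff forall_3)
  thus ?thesis by (auto simp: pt_def image_iff) metis
qed

lemma spectral_form_swap: "spectral_form B A v = spectral_form A B (swap23 v)"
  by (simp add: spectral_form_def add_ac)

lemma secant_triple_swap:
  assumes "secant_triple (spectral_form B A) p q r"
  shows "secant_triple (spectral_form A B) (swap23 p) (swap23 q) (swap23 r)"
proof -
  from assms obtain a b c where abc: "a \<noteq> 0" "b \<noteq> 0" "c \<noteq> 0" "a *s p + b *s q + c *s r = 0"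
    by (auto simp: secant_triple_def)
  have "a *s swap23 p + b *s swap23 q + c *s swap23 r = swap23 (a *s p + b *s q + c *s r)"
    by (simp add: vec_eq_iff forall_3)
  hence "a *s swap23 p + b *s swap23 q + c *s swap23 r = 0"
    using abc(4) by (simp add: vec_eq_iff forall_3)
  with assms abc(1-3) show ?thesis
    unfolding secant_triple_def spectral_form_swap[of B A] swap23_combination by blast
qed

text \<open>This symmetry lets the same point \<open>T\<close> serve the lines from
  \<open>X_1\<close> and from \<open>P_1\<close>.\<close>

lemma T_vec_swap: "swap23 (T_vec \<psi> \<phi> B A \<xi> h) = T_vec \<phi> \<psi> A B h \<xi>"
  by (simp add: vec_eq_iff forall_3 T_vec_def Let_def vector_3 mult.commute)

lemma eigenvalues_nonempty: "eigenvalues A \<noteq> {}"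
proof -
  obtain a b c where "\<And>x. det (mat x - A) = (x - a) * (x - b) * (x - c)"
    by (rule charpoly_factorization[of A]) blast
  hence "a \<in> eigenvalues A" by (simp add: eigenvalues_det)
  thus ?thesis by blast
qed

section \<open>The transposition for generic pairs\<close>

definition swap_action :: "mat3 \<Rightarrow> mat3 \<Rightarrow> bool" where
  "swap_action A B \<longleftrightarrow> card (eigenvalues A) = 3 \<and> card (eigenvalues B) = 3 \<and>
     (\<forall>h \<xi>. eigenvalue_ordering A h \<longrightarrow> eigenvalue_ordering B \<xi> \<longrightarrow>
        (let F = spectral_form A B;
             P1 = pt (vector [h 1, - 1, 0]);
             X1 = pt (vector [\<xi> 1, 0, - 1])
         in P1 \<in> curve F \<and> X1 \<in> curve F \<and>
            (\<exists>Q T Y. Q \<in> curve F \<and>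
               (\<forall>Z. distinguished_point A B h Z \<longleftrightarrow> Z = Q) \<and>
               (\<forall>Z. third_point F X1 Q Z \<longleftrightarrow> Z = T) \<and>
               (\<forall>Z. third_point F P1 T Z \<longleftrightarrow> Z = Y) \<and>
               (\<forall>Z. distinguished_point B A \<xi> Z \<longleftrightarrow> Z = swap23 ` Y))))"

lemma swap_action_conj: "invertible S \<Longrightarrow> swap_action (mat_conj S A) (mat_conj S B) \<longleftrightarrow> swap_action A B"
  by (simp add: swap_action_def spectral_form_conj eigenvalues_conj distinguished_point_conj
      eigenvalue_ordering_def)

text \<open>The \<open>dchar\<close> factors make the eigenvalues distinct. The two obstructions
  serve the pair and its transpose, with left eigenvectors that are polynomial in the
  eigenvalue.\<close>

definition genericity :: "mat3 \<times> mat3 \<Rightarrow> complex \<Rightarrow> complex \<Rightarrow> complex" where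
  "genericity p h \<xi> = dchar (fst p) h * dchar (snd p) \<xi> *
     obstruction (eigrow (fst p) h) (eigrow (snd p) \<xi>) (fst p) (snd p) h \<xi> *
     obstruction (eigrow (snd p) \<xi>) (eigrow (fst p) h) (snd p) (fst p) \<xi> h"

lemma poly_fun2_genericity: "poly_fun2 genericity"
  unfolding genericity_def
  by (intro poly_fun2_mult poly_fun2_dchar poly_fun2_obstruction poly_fun2_vec_eigrow poly_fun2_mat_fst poly_fun2_mat_snd poly_fun2_var1 poly_fun2_var2)

lemma swap_action_generic:
  assumes gen: "\<And>h \<xi>. h \<in> eigenvalues A \<Longrightarrow> \<xi> \<in> eigenvalues B \<Longrightarrow> genericity (A, B) h \<xi> \<noteq> 0"
  shows "swap_action A B"
proof -
  \<comment> \<open>Genericity concerns pairs of eigenvalues, so a conclusion about one matrix needs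
    some eigenvalue of the other.\<close>
  have "card (eigenvalues A) = 3" "card (eigenvalues B) = 3"
    using gen eigenvalues_nonempty[of A] eigenvalues_nonempty[of B]
    by (auto intro!: card_eigenvalues simp: genericity_def)
  moreover
  {
    fix h \<xi> assume h: "eigenvalue_ordering A h" and \<xi>: "eigenvalue_ordering B \<xi>"
    define F where "F = spectral_form A B"
    define \<phi> where "\<phi> = eigrow A (h 1)"
    define \<psi> where "\<psi> = eigrow B (\<xi> 1)"
    define q where "q = Q_vec A B (normal \<phi> B)"
    define y where "y = Q_vec B A (normal \<psi> A)"
    define t where "t = T_vec \<phi> \<psi> A B (h 1) (\<xi> 1)"
    define p1 where "p1 = (vector [h 1, - 1, 0] :: complex^3)"
    define x1 where "x1 = (vector [\<xi> 1, 0, - 1] :: complex^3)"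
    have h1: "h 1 \<in> eigenvalues A" and \<xi>1: "\<xi> 1 \<in> eigenvalues B"
      using h \<xi> by (auto intro: eigenvalue_ordering_in)
    have \<phi>: "\<phi> v* A = h 1 *s \<phi>" and \<psi>: "\<psi> v* B = \<xi> 1 *s \<psi>"
      unfolding \<phi>_def \<psi>_def by (simp_all add: eigrow_eigenvector h1 \<xi>1)
    have ob: "obstruction \<phi> \<psi> A B (h 1) (\<xi> 1) \<noteq> 0" "obstruction \<psi> \<phi> B A (\<xi> 1) (h 1) \<noteq> 0"
      using gen[OF h1 \<xi>1] by (simp_all add: genericity_def \<phi>_def \<psi>_def)
    have xqt: "secant_triple F x1 q t"
      unfolding F_def x1_def q_def t_def by (rule distinguished_secant_triple[OF \<phi> \<psi> ob(1)])
    \<comment> \<open>The collinearity result for \<open>(B, A)\<close>, carried back by the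
      transposition. Rotating the triple then makes the transposed distinguished point the third one
      on the line through \<open>P_1\<close> and \<open>T\<close>.\<close>
    have "secant_triple (spectral_form A B) (swap23 (vector [h 1, 0, - 1])) (swap23 y) (swap23 (T_vec \<psi> \<phi> B A (\<xi> 1) (h 1)))"
      unfolding y_def by (rule secant_triple_swap[OF distinguished_secant_triple[OF \<psi> \<phi> ob(2)]])
    moreover have "swap23 (vector [h 1, 0, - 1]) = p1"
      by (simp add: p1_def vec_eq_iff forall_3 vector_3)
    ultimately have "secant_triple F p1 (swap23 y) t" by (simp add: F_def T_vec_swap t_def)
    hence pty: "secant_triple F p1 t (swap23 y)" by (rule secant_triple_rotate)
    have nz: "p1 \<noteq> 0" "x1 \<noteq> 0" "q \<noteq> 0"
      by (auto simp: vec_eq_iff forall_3 p1_def x1_def q_def Q_vec_def vector_3)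
    have d: "cross (normal \<phi> B) (A *v normal \<phi> B) $ 1 \<noteq> 0" "cross (normal \<psi> A) (B *v normal \<psi> A) $ 1 \<noteq> 0"
      using ob by (auto simp: obstruction_def Let_def simp del: cross_nth)
    have "pt p1 \<in> curve F \<and> pt x1 \<in> curve F \<and> pt q \<in> curve F"
      using xqt pty nz by (simp add: F_def curve_spectral_form_pt secant_triple_def)
    moreover have "distinguished_point A B h Z \<longleftrightarrow> Z = pt q" for Z
      unfolding q_def by (rule distinguished_point_iff[OF h \<phi> d(1)])
    moreover have "distinguished_point B A \<xi> Z \<longleftrightarrow> Z = swap23 ` pt (swap23 y)" for Z
      unfolding swap23_image_pt swap23_swap23 y_def by (rule distinguished_point_iff[OF \<xi> \<psi> d(2)])
    moreover have "third_point F (pt x1) (pt q) Z \<longleftrightarrow> Z = pt t" for Z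
      using third_point_iff[OF xqt[unfolded F_def]] by (simp add: F_def)
    moreover have "third_point F (pt p1) (pt t) Z \<longleftrightarrow> Z = pt (swap23 y)" for Z
      using third_point_iff[OF pty[unfolded F_def]] by (simp add: F_def)
    ultimately have "pt p1 \<in> curve F \<and> pt x1 \<in> curve F \<and>
            (\<exists>Q T Y. Q \<in> curve F \<and>
               (\<forall>Z. distinguished_point A B h Z \<longleftrightarrow> Z = Q) \<and>
               (\<forall>Z. third_point F (pt x1) Q Z \<longleftrightarrow> Z = T) \<and>
               (\<forall>Z. third_point F (pt p1) T Z \<longleftrightarrow> Z = Y) \<and>
               (\<forall>Z. distinguished_point B A \<xi> Z \<longleftrightarrow> Z = swap23 ` Y))" by blast
  }
  ultimately show ?thesis unfolding swap_action_def Let_def by blast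
qed

text \<open>The exchange of the two generators is its own inverse.\<close>

lemma GL2Z_acts_swap: "GL2Z_acts (vector [vector [0, 1], vector [1, 0]]) (A, B) (B, A)"
proof -
  define \<phi> where "\<phi> c = [(case c of C1 \<Rightarrow> C2 | C2 \<Rightarrow> C1, True)]" for c
  have "word_subst \<phi> (\<phi> c) = [(c, True)]" for c
    by (cases c) (simp_all add: word_subst_def \<phi>_def)
  hence "free_aut \<phi>" unfolding free_aut_def free_eq_def by (intro exI[of _ \<phi>]) simp
  moreover have "ab_matrix \<phi> = vector [vector [0, 1], vector [1, 0]]"
    by (simp add: ab_matrix_def exp_sum_def \<phi>_def)
  moreover have "sim_conj p p" for p
  proof -
    have "invertible (mat 1 :: mat3)" by (simp add: invertible_det_nz)
    moreover from matrix_inv_cancel(1)[OF this] have "matrix_inv (mat 1 :: mat3) = mat 1" by simp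
    ultimately show ?thesis unfolding sim_conj_def by (intro exI[of _ "mat 1"]) simp
  qed
  moreover have "(word_eval (A, B) (\<phi> C1), word_eval (A, B) (\<phi> C2)) = (B, A)"
    by (simp add: \<phi>_def)
  ultimately show ?thesis unfolding GL2Z_acts_def by metis
qed

section \<open>An explicit pair in general position\<close>

definition A0 :: mat3 where
  "A0 = vector [vector [-2, 0, -2], vector [0, 0, 1], vector [-1, 3, 0]]"

definition B0 :: mat3 where
  "B0 = vector [vector [-1, 1, -1], vector [1, -1, -1], vector [0, -1, 0]]"

lemma eigenvalues_A0: "eigenvalues A0 = {-3, -1, 2}"
proof -
  have "det (mat x - A0) = (x + 3) * ((x + 1) * (x - 2))" for x
    by (simp add: det_3 A0_def mat_def vector_3 algebra_simps)
  thus ?thesis by (auto simp: eigenvalues_det eq_neg_iff_add_eq_0)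
qed

lemma eigenvalues_B0: "eigenvalues B0 = {-2, -1, 1}"
proof -
  have "det (mat x - B0) = (x + 2) * ((x + 1) * (x - 1))" for x
    by (simp add: det_3 B0_def mat_def vector_3 algebra_simps)
  thus ?thesis by (auto simp: eigenvalues_det eq_neg_iff_add_eq_0)
qed

lemma eigenvalue_ordering_exists:
  assumes "card (eigenvalues A) = 3" shows "\<exists>h. eigenvalue_ordering A h"
  unfolding eigenvalue_ordering_def
  using assms finite_same_card_bij[of "UNIV :: 3 set" "eigenvalues A"]
  by (simp add: card_ge_0_finite)

lemma vector3_computations:
  "cross (vector [a, b, c]) (vector [d, e, f]) = vector [b * f - c * e, c * d - a * f, a * e - b * d]"
  "bil (vector [a, b, c]) (vector [d, e, f]) = a * d + b * e + c * f"
  "vector [a, b, c] v* A0 = vector [-2 * a - c, 3 * c, b - 2 * a]"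
  "vector [a, b, c] v* B0 = vector [b - a, a - b - c, - a - b]"
  "A0 *v vector [a, b, c] = vector [-2 * a - 2 * c, c, 3 * b - a]"
  "B0 *v vector [a, b, c] = vector [b - a - c, a - b - c, - b]"
  by (simp_all add: cross_def bil_def vec_eq_iff forall_3 vector_matrix_mult_def
      matrix_vector_mult_def sum_3 A0_def B0_def vector_3 algebra_simps)

lemma spectral_form_0:
  "spectral_form A0 B0 (vector [s, t, 0]) = s^3 - 2 * s^2 * t - 5 * s * t^2 + 6 * t^3"
  "spectral_form B0 A0 (vector [s, t, 0]) = s^3 - 2 * s^2 * t - s * t^2 + 2 * t^3"
  by (simp_all add: spectral_form_pencil pencil_nth det_3 A0_def B0_def vector_3 algebra_simps
      power2_eq_square power3_eq_cube)

lemma dchar_0: "dchar A0 x = 3 * x^2 + 4 * x - 5" "dchar B0 x = 3 * x^2 + 4 * x - 1"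
  by (simp_all add: dchar_def A0_def B0_def vector_3 power2_eq_square algebra_simps)

lemma eigrow_0:
  "eigrow A0 h = vector [h * h - 3, - 6, - 2 * h]"
  "eigrow B0 h = vector [(h + 1) * h - 1, h + 1, - h - 2]"
  by (simp_all add: eigrow_def A0_def B0_def vector_3 vector3_computations algebra_simps)

text \<open>Both spectra consist of three integers, so nine explicit evaluations suffice.\<close>

lemma genericity_witness:
  assumes "h \<in> eigenvalues A0" "\<xi> \<in> eigenvalues B0"
  shows "genericity (A0, B0) h \<xi> \<noteq> 0"
  using assms unfolding eigenvalues_A0 eigenvalues_B0
  by (auto simp: genericity_def obstruction_def Let_def weight_def row_coeff_def image_coeff_def normal_def
      eigrow_0 vector3_computations spectral_form_0 vector_3 dchar_0)


theorem proposition3p1: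
  shows "\<exists>G. G \<noteq> {} \<and> zariski_open G \<and> (\<forall>p q. p \<in> G \<longrightarrow> sim_conj p q \<longrightarrow> q \<in> G) \<and>
    (\<forall>A B. (A, B) \<in> G \<longrightarrow>
       GL2Z_acts (vector [vector [0, 1], vector [1, 0]]) (A, B) (B, A) \<and>
       (\<forall>v. spectral_form B A v = spectral_form A B (swap23 v)) \<and>
       card (eigenvalues A) = 3 \<and> card (eigenvalues B) = 3 \<and>
       (\<forall>h \<xi>. eigenvalue_ordering A h \<longrightarrow> eigenvalue_ordering B \<xi> \<longrightarrow>
          (let F = spectral_form A B;
               P1 = pt (vector [h 1, - 1, 0]);
               X1 = pt (vector [\<xi> 1, 0, - 1])
           in P1 \<in> curve F \<and> X1 \<in> curve F \<and>
              (\<exists>Q T Y. Q \<in> curve F \<and>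
                 (\<forall>Z. distinguished_point A B h Z \<longleftrightarrow> Z = Q) \<and>
                 (\<forall>Z. third_point F X1 Q Z \<longleftrightarrow> Z = T) \<and>
                 (\<forall>Z. third_point F P1 T Z \<longleftrightarrow> Z = Y) \<and>
                 (\<forall>Z. distinguished_point B A \<xi> Z \<longleftrightarrow> Z = swap23 ` Y)))))"
proof -
  obtain f where f: "poly_fun f"
    and generic: "\<And>A B s t. f (A, B) \<noteq> 0 \<Longrightarrow> s \<in> eigenvalues A \<Longrightarrow> t \<in> eigenvalues B \<Longrightarrow>
       genericity (A, B) s t \<noteq> 0"
    and nonzero: "\<And>A B h \<xi>. eigenvalue_ordering A h \<Longrightarrow> eigenvalue_ordering B \<xi> \<Longrightarrow>
       (\<And>i j. genericity (A, B) (h i) (\<xi> j) \<noteq> 0) \<Longrightarrow> f (A, B) \<noteq> 0"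
    using eigenvalue_elimination[OF poly_fun2_genericity] by metis
  define G where "G = {p \<in> GL3_pairs. \<exists>S. invertible S \<and> f (mat_conj S (fst p), mat_conj S (snd p)) \<noteq> 0}"
  note open_G = zariski_open_saturation[OF f, folded G_def]
  \<comment> \<open>A member of \<open>G\<close> has a conjugate at which \<open>f\<close> is
    nonzero, and the conclusion is conjugation invariant.\<close>
  have swap: "swap_action A B" if "(A, B) \<in> G" for A B
  proof -
    from that obtain S where S: "invertible S" "f (mat_conj S A, mat_conj S B) \<noteq> 0"
      by (auto simp: G_def)
    have "swap_action (mat_conj S A) (mat_conj S B)"
      by (rule swap_action_generic) (rule generic[OF S(2)])
    thus ?thesis by (simp add: swap_action_conj[OF S(1)])
  qed
  have "(A0, B0) \<in> G"
  proof -
    have "card (eigenvalues A0) = 3" "card (eigenvalues B0) = 3"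
      by (simp_all add: eigenvalues_A0 eigenvalues_B0)
    then obtain h \<xi> where "eigenvalue_ordering A0 h" "eigenvalue_ordering B0 \<xi>"
      using eigenvalue_ordering_exists by blast
    hence "f (A0, B0) \<noteq> 0"
      by (rule nonzero) (intro genericity_witness eigenvalue_ordering_in; fact)
    moreover have "(A0, B0) \<in> GL3_pairs"
      by (simp add: GL3_pairs_def invertible_det_nz det_3 A0_def B0_def vector_3)
    ultimately show ?thesis
      unfolding G_def by (auto intro!: exI[of _ "mat 1"] simp: invertible_det_nz)
  qed
  hence "G \<noteq> {}" by blast
  with open_G swap show ?thesis
    unfolding swap_action_def by (intro exI[of _ G]) (blast intro: GL2Z_acts_swap spectral_form_swap)
qed

end
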